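(* Let $m,k$ be integers with $0<m\le k$, and let $0<p,q\le\infty$ (with the convention $1/\infty=0$). (i) If $p\neq\infty$, then there exist constants $c,C>0$, depending only on $p,q,k$, such that for all integers $n\ge\max(k,2)$, $$c\,A(n)\le M^{(k)}_{q,p}(n,m)\le C\,A(n),$$ where $$A(n)=\begin{cases} n^{2m+2/p-2/q}, & \text{if } m>1/q-1/p,\\ (\log n)^m, & \text{if } m=1/q-1/p,\\ 1, & \text{if } m<1/q-1/p.\end{cases}$$ (ii) If $p=\infty$, then there exist constants $c,C>0$, depending only on $q,k$, such that for all integers $n\ge\max(k,2)$, $$c\,B(n)\le M^{(k)}_{q,\infty}(n,m)\le C\,B(n),$$ where $$B(n)=\begin{cases} n^{2m-2/q}, & \text{if } m>1/q,\\ (\log n)^{m-1}, & \text{if } m=1/q,\\ 1, & \text{if } m<1/q.\end{cases}$$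
   Context: For an integer $k\ge 0$, a function $f:[a,b]\to\mathbb{R}$ is called absolutely monotone of order $k$ if $f^{(j)}(x)\ge 0$ for all $x\in[a,b]$ and all $0\le j\le k$. For integers $0\le k\le n$, $\triangle_n^{(k)}$ denotes the set of all real algebraic polynomials of degree at most $n$ that are absolutely monotone of order $k$ on $[-1,1]$. For $0<q<\infty$, $\|f\|_{L_q[-1,1]}=\left(\int_{-1}^1|f(x)|^q\,dx\right)^{1/q}$ (only a quasi-norm when $q<1$), and $\|f\|_{L_\infty[-1,1]}=\max_{x\in[-1,1]}|f(x)|$ for continuous $f$. For $0\le m\le n$ and $0\le k\le n$, $$M_{q,p}^{(k)}(n,m)=\sup_{P_n\in\triangle^{(k)}_n,\;P_n\not\equiv 0}\frac{\|P^{(m)}_n\|_{L_q[-1,1]}}{\|P_n\|_{L_p[-1,1]}}.$$ *)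

theory Defs
  imports "HOL-Analysis.Analysis" "HOL-Computational_Algebra.Polynomial"
begin

(* D j is the j-th derivative of f on [a,b], one-sided at the endpoints;
   for a < b the D j with j <= k are uniquely determined on [a,b]. *)
definition absolutely_monotone :: "nat \<Rightarrow> real \<Rightarrow> real \<Rightarrow> (real \<Rightarrow> real) \<Rightarrow> bool" where
  "absolutely_monotone k a b f \<longleftrightarrow>
    (\<exists>D. (\<forall>x\<in>{a..b}. D 0 x = f x)
       \<and> (\<forall>j<k. \<forall>x\<in>{a..b}. (D j has_real_derivative D (Suc j) x) (at x within {a..b}))
       \<and> (\<forall>j\<le>k. \<forall>x\<in>{a..b}. D j x \<ge> 0))"

definition abs_mono_polys :: "nat \<Rightarrow> nat \<Rightarrow> real poly set" where
  "abs_mono_polys k n = {P. degree P \<le> n \<and> absolutely_monotone k (- 1) 1 (poly P)}"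

(* Intended for 0 < q. The supremum is the maximum for continuous f, the only case used. *)
definition Lq_norm :: "ereal \<Rightarrow> (real \<Rightarrow> real) \<Rightarrow> real" where
  "Lq_norm q f =
    (if q = \<infinity> then (SUP x\<in>{-1..1}. \<bar>f x\<bar>)
     else (LINT x:{-1..1}|lborel. \<bar>f x\<bar> powr real_of_ereal q) powr (1 / real_of_ereal q))"

(* The supremum is taken in the extended reals, so that its finiteness is part of any upper bound. *)
definition markov_const :: "nat \<Rightarrow> ereal \<Rightarrow> ereal \<Rightarrow> nat \<Rightarrow> nat \<Rightarrow> ereal" where
  "markov_const k q p n m =
    (SUP P\<in>abs_mono_polys k n - {0}.
       ereal (Lq_norm q (poly ((pderiv ^^ m) P)) / Lq_norm p (poly P)))"

(* 1/p as a real number; in ereal, 1 / \<infinity> = 0. *)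
definition recip :: "ereal \<Rightarrow> real" where
  "recip p = real_of_ereal (1 / p)"

definition rate_finite :: "ereal \<Rightarrow> ereal \<Rightarrow> nat \<Rightarrow> nat \<Rightarrow> real" where
  "rate_finite q p m n =
    (if real m > recip q - recip p then real n powr (2 * real m + 2 * recip p - 2 * recip q)
     else if real m = recip q - recip p then ln (real n) ^ m
     else 1)"

definition rate_infinite :: "ereal \<Rightarrow> nat \<Rightarrow> nat \<Rightarrow> real" where
  "rate_infinite q m n =
    (if real m > recip q then real n powr (2 * real m - 2 * recip q)
     else if real m = recip q then ln (real n) ^ (m - 1)
     else 1)"

lemma absolutely_monotone_poly_iff:
  assumes "a < b"
  shows "absolutely_monotone k a b (poly P) \<longleftrightarrow>
    (\<forall>j\<le>k. \<forall>x\<in>{a..b}. poly ((pderiv ^^ j) P) x \<ge> 0)"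
proof
  assume "absolutely_monotone k a b (poly P)"
  then obtain D where D0: "\<forall>x\<in>{a..b}. D 0 x = poly P x"
    and D: "\<forall>j<k. \<forall>x\<in>{a..b}. (D j has_real_derivative D (Suc j) x) (at x within {a..b})"
    and nn: "\<forall>j\<le>k. \<forall>x\<in>{a..b}. D j x \<ge> (0::real)"
    unfolding absolutely_monotone_def by blast
  have eq: "j \<le> k \<Longrightarrow> \<forall>x\<in>{a..b}. D j x = poly ((pderiv ^^ j) P) x" for j
  proof (induction j)
    case 0
    then show ?case using D0 by simp
  next
    case (Suc j)
    show ?case
    proof
      fix x assume x: "x \<in> {a..b}"
      let ?Q = "(pderiv ^^ j) P"
      have "(poly ?Q has_real_derivative D (Suc j) x) (at x within {a..b})"
        using has_field_derivative_transform_within[of "D j" _ x "{a..b}" 1 "poly ?Q"] Suc D x by auto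
      moreover have "(poly ?Q has_real_derivative poly (pderiv ?Q) x) (at x within {a..b})"
        by (simp add: has_field_derivative_at_within poly_DERIV)
      moreover have "at x within {a..b} \<noteq> bot"
        using x assms by (simp add: trivial_limit_within islimpt_Icc)
      ultimately show "D (Suc j) x = poly ((pderiv ^^ Suc j) P) x"
        using has_field_derivative_unique by fastforce
    qed
  qed
  then show "\<forall>j\<le>k. \<forall>x\<in>{a..b}. poly ((pderiv ^^ j) P) x \<ge> 0"
    using nn by metis
next
  assume "\<forall>j\<le>k. \<forall>x\<in>{a..b}. poly ((pderiv ^^ j) P) x \<ge> 0"
  then show "absolutely_monotone k a b (poly P)"
    unfolding absolutely_monotone_def
    by (intro exI[of _ "\<lambda>j. poly ((pderiv ^^ j) P)"])
       (auto intro: has_field_derivative_at_within poly_DERIV)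
qed

end

theory Submission
  imports Defs
begin

text \<open>
  Write \<open>\<alpha> = 1/p\<close> and \<open>\<beta> = 1/q\<close>. Every rate comes from comparing a polynomial at distance \<open>w\<close> from
  the endpoint \<open>1\<close> with a power of \<open>w\<close>. If \<open>P, P', \<dots>, P\<^sup>(\<^sup>m\<^sup>)\<close> are nonnegative, Taylor expansion bounds
  the integral of \<open>P\<^sup>(\<^sup>m\<^sup>)\<close> over points at distance about \<open>w\<close> from \<open>1\<close> by \<open>w\<^bsup>1-m\<^esup>\<close> times a value of \<open>P\<close>
  closer to \<open>1\<close>, and since \<open>P\<close> increases, that value is at most about \<open>w\<^bsup>-\<alpha>\<^esup>\<close> times the \<open>L\<^sub>p\<close>
  norm of \<open>P\<close> on an adjacent interval of length comparable to \<open>w\<close>. A polynomial of degree \<open>n\<close> cannot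
  vary at scales below \<open>n\<^bsup>-2\<^esup>\<close>, so only the dyadic scales \<open>w = 4\<^bsup>-i\<^esup>\<close> above that size matter.
  For \<open>q < 1\<close> the shell at scale \<open>4\<^bsup>-i\<^esup>\<close> contributes \<open>4\<^bsup>ie\<^esup> A\<^sub>i\<^sup>q\<close> with
  \<open>e = q (m + \<alpha>) - 1\<close> to the integral of \<open>(P\<^sup>(\<^sup>m\<^sup>))\<^sup>q\<close>. The last scale dominates when \<open>m > \<beta> - \<alpha>\<close>
  and the first one when \<open>m < \<beta> - \<alpha>\<close>. In the critical case all of the roughly \<open>ln n\<close> scales count
  alike. There \<open>A\<^sub>i\<close> is controlled only through the sum of \<open>A\<^sub>i\<^sup>p\<close> (for \<open>p = \<infinity>\<close>, through the sum of
  \<open>A\<^sub>i\<close>, which telescopes), and concavity turns this into the power \<open>\<beta> - \<alpha> = m\<close> of the logarithm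
  (for \<open>p = \<infinity>\<close>, \<open>\<beta> - 1 = m - 1\<close>). For \<open>q \<ge> 1\<close> it is enough to combine \<open>\<integral> P\<^sup>(\<^sup>m\<^sup>) \<le> P\<^sup>(\<^sup>m\<^sup>-\<^sup>1\<^sup>)(1)\<close> with
  Markov's inequality.

  Markov's inequality \<open>\<parallel>P'\<parallel> \<le> 8 n\<^sup>2 \<parallel>P\<parallel>\<close> is the only place where the degree enters the upper bound.
  It follows from Lagrange interpolation at the nodes \<open>1, 4, 9, \<dots>, n\<^sup>2\<close>, whose weights at \<open>0\<close> are at
  most \<open>2\<close> (\<open>square_node_weight_le\<close>).

  For the lower bounds, the unnormalised Fejer kernel \<open>(1 - T\<^sub>M(x)) / (1 - x)\<close>, with \<open>T\<^sub>M\<close> the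
  Chebyshev polynomial, raised to a power and
  integrated \<open>k\<close> times from \<open>-1\<close>, is absolutely monotone of order \<open>k\<close> and lives at distance \<open>M\<^bsup>-2\<^esup>\<close>
  from \<open>1\<close> (\<open>bump_le\<close>, \<open>bump_ge\<close>). One such bump with \<open>M\<close> proportional to \<open>n\<close> gives the power rate,
  and \<open>M = 1\<close> gives the constant rate. The sum of bumps over the scales \<open>M = 2\<^sup>i\<close>, weighted so that its
  \<open>m\<close>-th derivative behaves like \<open>(1 - x)\<^bsup>-\<beta>\<^esup>\<close> and the sum itself at most like \<open>(1 - x)\<^bsup>-\<alpha>\<^esup>\<close>, gives
  the logarithmic rate.
\<close>

section \<open>Markov's inequality from interpolation at the squares\<close>

lemma lagrange_interpolation:
  fixes p :: "real poly" and A :: "real set"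
  assumes A: "finite A" and deg: "degree p < card A"
  shows "poly p t = (\<Sum>a\<in>A. poly p a * (\<Prod>b\<in>A-{a}. (t - b) / (a - b)))"
proof -
  define l where "l a = (\<Prod>b\<in>A-{a}. smult (1 / (a - b)) [:-b, 1:])" for a
  define L where "L = (\<Sum>a\<in>A. smult (poly p a) (l a))"
  have l: "poly (l a) t = (\<Prod>b\<in>A-{a}. (t - b) / (a - b))" for a t
    by (simp add: l_def poly_prod algebra_simps diff_divide_distrib)
  have "degree (l a) < card A" if "a \<in> A" for a
  proof -
    have "degree (l a) \<le> (\<Sum>b\<in>A-{a}. degree (smult (1 / (a - b)) [:-b, 1:]))"
      unfolding l_def by (rule order_trans[OF degree_prod_sum_le]) (use A in \<open>auto simp: o_def\<close>)
    also have "\<dots> \<le> (\<Sum>b\<in>A-{a}. 1)" by (intro sum_mono) auto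
    also have "\<dots> < card A" using A that by simp (metis card_gt_0_iff diff_less empty_iff zero_less_one One_nat_def)
    finally show ?thesis .
  qed
  hence "degree L < card A"
    unfolding L_def using deg
    by (intro degree_sum_less) (auto intro: le_less_trans[OF degree_smult_le])
  moreover have "poly p a = poly L a" if "a \<in> A" for a
  proof -
    have "poly (l c) a = (if c = a then 1 else 0)" if "c \<in> A" for c
    proof (cases "c = a")
      case False
      thus ?thesis using A \<open>a \<in> A\<close> by (auto simp: l)
    qed (simp add: l)
    hence "poly L a = (\<Sum>c\<in>A. poly p c * (if c = a then 1 else 0))"
      unfolding L_def by (simp add: poly_sum)
    thus ?thesis using A that by (simp add: if_distrib cong: if_cong)
  qed
  ultimately have "p = L" using deg by (intro poly_eqI_degree[of A]) auto
  hence "poly p t = poly L t" by simp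
  thus ?thesis by (simp add: L_def poly_sum l)
qed

text \<open>At a node \<open>j\<^sup>2\<close> the factors \<open>j\<^sup>2 - i\<^sup>2 = (j - i)(j + i)\<close> turn the product into factorials. The first
  induction treats \<open>i < j\<close>, the second one adds the factors with \<open>i > j\<close>.\<close>

lemma square_node_weight:
  assumes "1 \<le> j" "j \<le> n"
  shows "(\<Prod>i\<in>{1..n}-{j}. (real i)\<^sup>2 / \<bar>(real j)\<^sup>2 - (real i)\<^sup>2\<bar>)
         = 2 * (fact n)\<^sup>2 / (fact (n - j) * fact (n + j))"
proof -
  let ?w = "\<lambda>i. (real i)\<^sup>2 / \<bar>(real j)\<^sup>2 - (real i)\<^sup>2\<bar>"
  have lo: "(\<Prod>i\<in>{1..m}. ?w i) = (fact m)\<^sup>2 * fact (j - 1 - m) * fact j / (fact (j - 1) * fact (j + m))"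
    if "m < j" for m using that
  proof (induction m)
    case (Suc m)
    have f: "fact (j - 1 - m) = real (j - Suc m) * fact (j - 1 - Suc m)"
      using Suc.prems fact_reduce[of "j - 1 - m"] by (simp add: Suc_diff_Suc del: of_nat_diff)
    have "(real j)\<^sup>2 - (real (Suc m))\<^sup>2 = (real j - real (Suc m)) * (real j + real (Suc m))"
      by (simp add: power2_eq_square algebra_simps)
    hence w: "\<bar>(real j)\<^sup>2 - (real (Suc m))\<^sup>2\<bar> = real (j - Suc m) * real (j + Suc m)"
      using Suc.prems by (simp add: of_nat_diff)
    have nz: "real (j - Suc m) \<noteq> 0" "real (j + Suc m) \<noteq> 0" using Suc.prems by auto
    have "(\<Prod>i\<in>{1..Suc m}. ?w i) = ?w (Suc m) * (\<Prod>i\<in>{1..m}. ?w i)"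
      by (subst prod.nat_ivl_Suc') simp_all
    also have "\<dots> = (real (Suc m))\<^sup>2 / (real (j - Suc m) * real (j + Suc m)) *
       ((fact m)\<^sup>2 * (real (j - Suc m) * fact (j - 1 - Suc m)) * fact j / (fact (j - 1) * fact (j + m)))"
      using Suc w f by simp
    also have "\<dots> = (real (Suc m) * fact m)\<^sup>2 * fact (j - 1 - Suc m) * fact j / (fact (j - 1) * (real (j + Suc m) * fact (j + m)))"
      using nz by (simp add: divide_simps power_mult_distrib)
    also have "real (Suc m) * fact m = fact (Suc m)" by simp
    also have "real (j + Suc m) * fact (j + m) = fact (j + Suc m)" by simp
    finally show ?case .
  qed simp
  from \<open>j \<le> n\<close> show ?thesis
  proof (induction n rule: dec_induct)
    case base
    obtain i where i: "j = Suc i" using assms by (cases j) auto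
    have "{1..j}-{j} = {1..i}" using i by auto
    hence "(\<Prod>i\<in>{1..j}-{j}. ?w i) = (fact i)\<^sup>2 * fact j / (fact i * fact (j + i))"
      using lo[of i] i by simp
    also have "\<dots> = fact i * fact j / fact (j + i)" by (simp add: power2_eq_square)
    also have "\<dots> = 2 * (fact j)\<^sup>2 / fact (j + j)"
      using i by (simp add: power2_eq_square divide_simps)
    finally show ?case by simp
  next
    case (step n)
    have "{1..Suc n}-{j} = insert (Suc n) ({1..n}-{j})" using step by auto
    hence "(\<Prod>i\<in>{1..Suc n}-{j}. ?w i) = ?w (Suc n) * (2 * (fact n)\<^sup>2 / (fact (n - j) * fact (n + j)))"
      using step by simp
    also have "(real j)\<^sup>2 - (real (Suc n))\<^sup>2 = - ((real (Suc n) - real j) * (real (Suc n) + real j))"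
      by (simp add: power2_eq_square algebra_simps)
    hence "\<bar>(real j)\<^sup>2 - (real (Suc n))\<^sup>2\<bar> = real (Suc n - j) * real (Suc n + j)"
      using step by (simp only: abs_minus_cancel abs_mult) (simp add: of_nat_diff)
    also have "(real (Suc n))\<^sup>2 / (real (Suc n - j) * real (Suc n + j)) * (2 * (fact n)\<^sup>2 / (fact (n - j) * fact (n + j)))
      = 2 * (real (Suc n) * fact n)\<^sup>2 / ((real (Suc n - j) * fact (n - j)) * (real (Suc n + j) * fact (n + j)))"
      by (simp add: power_mult_distrib mult_ac)
    also have "real (Suc n - j) * fact (n - j) = fact (Suc n - j)"
      using step by (simp add: Suc_diff_le)
    also have "real (Suc n + j) * fact (n + j) = fact (Suc n + j)" by simp
    also have "real (Suc n) * fact n = fact (Suc n)" by simp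
    finally show ?case .
  qed
qed

text \<open>The weight is twice the ratio of the binomial coefficients of \<open>2n\<close> over \<open>n - j\<close> and over \<open>n\<close>, and the
  central one is the largest. Quadratic spacing of the nodes is what keeps the weights bounded.\<close>

lemma square_node_weight_le:
  assumes "1 \<le> j" "j \<le> n"
  shows "(\<Prod>i\<in>{1..n}-{j}. (real i)\<^sup>2 / \<bar>(real j)\<^sup>2 - (real i)\<^sup>2\<bar>) \<le> 2"
proof -
  have "(2*n) choose (n - j) \<le> (2*n) choose n" by (rule binomial_maximum')
  hence "real ((2*n) choose (n - j)) \<le> real ((2*n) choose n)" by (simp only: of_nat_le_iff)
  moreover have "2 * n - (n - j) = n + j" using assms by simp
  ultimately have "fact (2*n) / (fact (n-j) * fact (n+j)) \<le> (fact (2*n) / (fact n * fact n) :: real)"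
    using assms by (simp add: binomial_fact)
  hence "fact (2*n) * (1 / (fact (n-j) * fact (n+j))) \<le> (fact (2*n) * (1 / (fact n * fact n)) :: real)"
    by simp
  hence "1 / (fact (n-j) * fact (n+j)) \<le> (1 / (fact n * fact n) :: real)"
    by (rule mult_left_le_imp_le) simp
  hence "(fact n * fact n) / (fact (n-j) * fact (n+j)) \<le> (1::real)"
    by (simp add: divide_simps)
  thus ?thesis unfolding square_node_weight[OF assms] by (simp add: power2_eq_square divide_simps)
qed

lemma sum_inverse_squares_le: "(\<Sum>j\<in>{1..n}. 1 / (real j)\<^sup>2) \<le> 2"
proof -
  have "(\<Sum>j\<in>{1..Suc n}. 1 / (real j)\<^sup>2) \<le> 2 - 1 / real (Suc n)" for n
  proof (induction n)
    case (Suc n)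
    have "1 / (real n + 2)\<^sup>2 \<le> 1 / (real n + 1) - 1 / (real n + 2)"
      by (simp add: divide_simps power2_eq_square)
    thus ?case using Suc by (simp add: add.commute)
  qed simp
  note bound = this
  show ?thesis
  proof (cases n)
    case (Suc m)
    have "2 - 1 / real (Suc m) \<le> 2" by simp
    with bound[of m] show ?thesis unfolding Suc by (rule order_trans)
  qed simp
qed

text \<open>The derivative at \<open>0\<close> is the value at \<open>0\<close> of \<open>r(t) = (p(t) - p(0)) / t\<close>, which has degree below \<open>n\<close> and is
  therefore a combination of its values at \<open>1, 4, \<dots>, n\<^sup>2\<close>. There \<open>r(j\<^sup>2)\<close> is at most \<open>2B / j\<^sup>2\<close> in
  modulus, so the bounded weights give a convergent sum.\<close>

lemma deriv_at_zero_le_sup: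
  fixes p :: "real poly"
  assumes deg: "degree p \<le> n"
    and B: "\<And>t. 0 \<le> t \<Longrightarrow> t \<le> (real n)\<^sup>2 \<Longrightarrow> \<bar>poly p t\<bar> \<le> B"
  shows "\<bar>poly (pderiv p) 0\<bar> \<le> 8 * B"
proof -
  define c where "c = poly p 0"
  have "poly (p - [:c:]) 0 = 0" by (simp add: c_def)
  hence "[:0, 1:] dvd p - [:c:]" by (simp add: dvd_iff_poly_eq_0)
  then obtain r where r: "p - [:c:] = [:0, 1:] * r" by (rule dvdE)
  have p: "p = [:c:] + [:0, 1:] * r" using r by (simp add: algebra_simps)
  have pd: "poly (pderiv p) 0 = poly r 0" unfolding p by (simp add: pderiv_pCons pderiv_add)
  have B0: "0 \<le> B" using B[of 0] by simp
  show ?thesis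
  proof (cases "n = 0")
    case True
    hence "pderiv p = 0" using deg by (simp add: pderiv_eq_0_iff)
    thus ?thesis using B0 by simp
  next
    case False
    define A where "A = (\<lambda>j. (real j)\<^sup>2) ` {1..n}"
    have inj: "inj_on (\<lambda>j. (real j)\<^sup>2) {1..n}" by (auto simp: inj_on_def)
    have cardA: "card A = n" unfolding A_def using inj by (simp add: card_image)
    have "degree r < n"
    proof (cases "r = 0")
      case False
      have "degree (p - [:c:]) \<le> n" using deg by (intro degree_diff_le) auto
      moreover have "degree ([:0, 1:] * r) = 1 + degree r"
        using False by (subst degree_mult_eq) auto
      ultimately show ?thesis using r by simp
    qed (use \<open>n \<noteq> 0\<close> in simp)
    hence "poly r 0 = (\<Sum>a\<in>A. poly r a * (\<Prod>b\<in>A-{a}. (0 - b) / (a - b)))"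
      using cardA by (intro lagrange_interpolation) (auto simp: A_def)
    also have "\<dots> = (\<Sum>j\<in>{1..n}. poly r ((real j)\<^sup>2) * (\<Prod>b\<in>A-{(real j)\<^sup>2}. (0 - b) / ((real j)\<^sup>2 - b)))"
      unfolding A_def by (subst sum.reindex[OF inj]) simp
    finally have "\<bar>poly r 0\<bar> \<le> (\<Sum>j\<in>{1..n}. \<bar>poly r ((real j)\<^sup>2) * (\<Prod>b\<in>A-{(real j)\<^sup>2}. (0 - b) / ((real j)\<^sup>2 - b))\<bar>)"
      by simp
    also have "\<dots> \<le> (\<Sum>j\<in>{1..n}. 4 * B * (1 / (real j)\<^sup>2))"
    proof (rule sum_mono)
      fix j assume j: "j \<in> {1..n}"
      have "A - {(real j)\<^sup>2} = (\<lambda>i. (real i)\<^sup>2) ` ({1..n} - {j})"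
        unfolding A_def by auto
      hence "(\<Prod>b\<in>A-{(real j)\<^sup>2}. (0 - b) / ((real j)\<^sup>2 - b)) =
          (\<Prod>i\<in>{1..n}-{j}. (0 - (real i)\<^sup>2) / ((real j)\<^sup>2 - (real i)\<^sup>2))"
        by (simp add: prod.reindex[OF inj_on_subset[OF inj]])
      hence "\<bar>\<Prod>b\<in>A-{(real j)\<^sup>2}. (0 - b) / ((real j)\<^sup>2 - b)\<bar> =
          (\<Prod>i\<in>{1..n}-{j}. (real i)\<^sup>2 / \<bar>(real j)\<^sup>2 - (real i)\<^sup>2\<bar>)"
        by (simp add: abs_prod)
      hence w: "\<bar>\<Prod>b\<in>A-{(real j)\<^sup>2}. (0 - b) / ((real j)\<^sup>2 - b)\<bar> \<le> 2"
        using square_node_weight_le[of j n] j by simp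
      have "poly p ((real j)\<^sup>2) = c + (real j)\<^sup>2 * poly r ((real j)\<^sup>2)"
        by (subst p) simp
      hence "poly r ((real j)\<^sup>2) = (poly p ((real j)\<^sup>2) - poly p 0) / (real j)\<^sup>2"
        using j by (simp add: c_def)
      moreover have "\<bar>poly p ((real j)\<^sup>2) - poly p 0\<bar> \<le> 2 * B"
        using B[of "(real j)\<^sup>2"] B[of 0] j by simp
      ultimately have "\<bar>poly r ((real j)\<^sup>2)\<bar> \<le> 2 * B / (real j)\<^sup>2"
        by (simp add: divide_right_mono)
      hence "\<bar>poly r ((real j)\<^sup>2)\<bar> * \<bar>\<Prod>b\<in>A-{(real j)\<^sup>2}. (0 - b) / ((real j)\<^sup>2 - b)\<bar>
          \<le> 2 * B / (real j)\<^sup>2 * 2"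
        using w B0 by (intro mult_mono) auto
      thus "\<bar>poly r ((real j)\<^sup>2) * (\<Prod>b\<in>A-{(real j)\<^sup>2}. (0 - b) / ((real j)\<^sup>2 - b))\<bar>
          \<le> 4 * B * (1 / (real j)\<^sup>2)" by (simp add: abs_mult)
    qed
    also have "\<dots> = 4 * B * (\<Sum>j\<in>{1..n}. 1 / (real j)\<^sup>2)" by (rule sum_distrib_left[symmetric])
    also have "\<dots> \<le> 4 * B * 2" using B0 sum_inverse_squares_le by (intro mult_left_mono) auto
    finally show ?thesis using pd by simp
  qed
qed

text \<open>Every point \<open>x\<close> of \<open>[-1, 1]\<close> is an endpoint of an interval of length \<open>1\<close> inside \<open>[-1, 1]\<close>. Stretching
  that interval to \<open>[0, n\<^sup>2]\<close> reduces the claim to the derivative at \<open>0\<close>. The constant \<open>8\<close> is not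
  sharp (the sharp one is \<open>1\<close>).\<close>

lemma markov_inequality:
  fixes P :: "real poly"
  assumes deg: "degree P \<le> n" and B: "\<And>x. x \<in> {-1..1} \<Longrightarrow> \<bar>poly P x\<bar> \<le> B"
    and x: "x \<in> {-1..1}"
  shows "\<bar>poly (pderiv P) x\<bar> \<le> 8 * (real n)\<^sup>2 * B"
proof (cases "n = 0")
  case True
  hence "pderiv P = 0" using deg by (simp add: pderiv_eq_0_iff)
  thus ?thesis using True by simp
next
  case False
  \<comment> \<open>The sign of \<open>c\<close> chooses the direction in which an interval of length \<open>1\<close> fits.\<close>
  define c where "c = (if x \<le> 0 then 1 else -1) / (real n)\<^sup>2"
  have n2: "(real n)\<^sup>2 > 0" using False by simp
  define p where "p = pcompose P [:x, c:]"
  have "degree p \<le> degree P * degree [:x, c:]" unfolding p_def by (simp add: degree_pcompose)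
  also have "\<dots> \<le> n" using deg by (auto intro: le_trans)
  finally have "degree p \<le> n" .
  moreover have "\<bar>poly p t\<bar> \<le> B" if "0 \<le> t" "t \<le> (real n)\<^sup>2" for t
  proof -
    have "0 \<le> t / (real n)\<^sup>2" "t / (real n)\<^sup>2 \<le> 1" using that n2 by auto
    hence "x + t * c \<in> {-1..1}" using x by (auto simp: c_def)
    thus ?thesis unfolding p_def by (simp add: poly_pcompose B)
  qed
  ultimately have "\<bar>poly (pderiv p) 0\<bar> \<le> 8 * B" by (rule deriv_at_zero_le_sup)
  moreover have "poly (pderiv p) 0 = poly (pderiv P) x * c"
    unfolding p_def by (simp add: pderiv_pcompose poly_pcompose pderiv_pCons)
  moreover have "\<bar>c\<bar> = 1 / (real n)\<^sup>2" by (simp add: c_def)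
  ultimately show ?thesis using n2 by (simp add: abs_mult field_simps)
qed

text \<open>The slope is at most \<open>8 n\<^sup>2 B\<close>, so a polynomial that attains its maximal modulus \<open>B\<close> at \<open>1\<close> loses at
  most \<open>B / 2\<close> within distance \<open>1 / (16 n\<^sup>2)\<close>.\<close>

lemma poly_ge_half_near_one:
  fixes P :: "real poly"
  assumes deg: "degree P \<le> n" and n: "1 \<le> n" and B: "\<And>x. x \<in> {-1..1} \<Longrightarrow> \<bar>poly P x\<bar> \<le> B"
    and one: "poly P 1 = B" and x: "x \<in> {1 - 1 / (16 * (real n)\<^sup>2)..1}"
  shows "B / 2 \<le> poly P x"
proof -
  have n2: "1 \<le> (real n)\<^sup>2" using n by simp
  have "1 / (16 * (real n)\<^sup>2) \<le> 1" using n2 by (simp add: divide_simps)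
  hence x': "x \<in> {0..1}" using x by auto
  have B0: "0 \<le> B" using B[of 1] by simp
  define M where "M = 8 * (real n)\<^sup>2 * B"
  have "poly P 1 - M * 1 \<le> poly P x - M * x"
  proof (rule DERIV_nonpos_imp_nonincreasing[of x 1 "\<lambda>x. poly P x - M * x"])
    fix u assume u: "x \<le> u" "u \<le> 1"
    have "((\<lambda>x. poly P x - M * x) has_real_derivative poly (pderiv P) u - M) (at u)"
      by (auto intro!: derivative_eq_intros)
    moreover have "poly (pderiv P) u \<le> M"
      using markov_inequality[OF deg B, of u] u x' unfolding M_def by auto
    ultimately show "\<exists>d. ((\<lambda>x. poly P x - M * x) has_real_derivative d) (at u) \<and> d \<le> 0"
      by (intro exI[of _ "poly (pderiv P) u - M"]) auto
  qed (use x' in auto)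
  moreover have "M * (1 - x) \<le> M * (1 / (16 * (real n)\<^sup>2))"
    using x B0 by (intro mult_left_mono) (auto simp: M_def)
  moreover have "M * (1 / (16 * (real n)\<^sup>2)) = B / 2" using n by (simp add: M_def)
  ultimately show ?thesis using one by (simp add: algebra_simps)
qed

lemma higher_markov_inequality:
  fixes P :: "real poly"
  assumes deg: "degree P \<le> n" and B: "\<And>x. x \<in> {-1..1} \<Longrightarrow> \<bar>poly P x\<bar> \<le> B"
    and x: "x \<in> {-1..1}"
  shows "\<bar>poly ((pderiv ^^ j) P) x\<bar> \<le> (8 * (real n)\<^sup>2) ^ j * B"
  using x
proof (induction j arbitrary: x)
  case (Suc j)
  have "degree ((pderiv ^^ j) P) \<le> n" using deg by (simp add: degree_higher_pderiv)
  from markov_inequality[OF this Suc.IH Suc.prems] show ?case by (simp add: mult_ac)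
qed (use B in auto)

section \<open>Norms, shells and concavity\<close>

lemma Lq_norm_real:
  assumes q: "0 < q" and f: "continuous_on {-1..1} f"
  shows "Lq_norm (ereal q) f = (integral {-1..1} (\<lambda>x. \<bar>f x\<bar> powr q)) powr (1 / q)"
proof -
  have "continuous_on {-1..1} (\<lambda>x. \<bar>f x\<bar> powr q)"
    using q f by (intro continuous_on_powr' continuous_intros) auto
  hence "set_integrable lborel {-1..1} (\<lambda>x. \<bar>f x\<bar> powr q)"
    by (rule borel_integrable_atLeastAtMost')
  thus ?thesis unfolding Lq_norm_def by (simp add: set_borel_integral_eq_integral(2))
qed

lemma continuous_on_abs_powr:
  fixes f :: "real \<Rightarrow> real"
  assumes "0 < q" "continuous_on S f"
  shows "continuous_on S (\<lambda>x. \<bar>f x\<bar> powr q)"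
  using assms by (intro continuous_on_powr' continuous_intros) auto

lemma integrable_powr:
  fixes f :: "real \<Rightarrow> real"
  assumes "0 < q" and "continuous_on {a..b} f"
  shows "(\<lambda>x. \<bar>f x\<bar> powr q) integrable_on {a..b}"
  using assms by (intro integrable_continuous_real continuous_on_powr' continuous_intros) auto

lemma integral_ge_const:
  fixes f :: "real \<Rightarrow> real"
  assumes "f integrable_on {a..b}" "a \<le> b" "\<And>x. x \<in> {a..b} \<Longrightarrow> c \<le> f x"
  shows "c * (b - a) \<le> integral {a..b} f"
proof -
  have "integral {a..b} (\<lambda>_. c) \<le> integral {a..b} f"
    using assms by (intro integral_le) auto
  thus ?thesis using assms by (simp add: mult.commute)
qed

lemma integral_le_const:
  fixes f :: "real \<Rightarrow> real"
  assumes "f integrable_on {a..b}" "a \<le> b" "\<And>x. x \<in> {a..b} \<Longrightarrow> f x \<le> c"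
  shows "integral {a..b} f \<le> c * (b - a)"
proof -
  have "integral {a..b} f \<le> integral {a..b} (\<lambda>_. c)"
    using assms by (intro integral_le) auto
  thus ?thesis using assms by (simp add: mult.commute)
qed

text \<open>Shells shrinking geometrically towards \<open>1\<close> tile an interval. The three uses differ in the distance
  \<open>a\<close> of the first shell from \<open>1\<close>: \<open>2\<close>, \<open>1/4\<close> and \<open>1/32\<close>.\<close>

lemma integral_shells:
  fixes f :: "real \<Rightarrow> real"
  assumes f: "continuous_on {-1..1} f" and a: "0 < a" "a \<le> 2"
  shows "(\<Sum>i<L. integral {1 - a/4^i .. 1 - a/4^Suc i} f) = integral {1 - a .. 1 - a/4^L} f"
proof (induction L)
  case (Suc L)
  have "a / 4^L \<le> a" "a / 4^Suc L \<le> a / 4^L"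
    using a by (auto simp: divide_simps)
  moreover have "0 < a / 4^Suc L" using a by simp
  ultimately have "integral {1 - a..1 - a/4^L} f + integral {1 - a/4^L..1 - a/4^Suc L} f
      = integral {1 - a..1 - a/4^Suc L} f"
    using a by (intro Henstock_Kurzweil_Integration.integral_combine integrable_continuous_real
        continuous_on_subset[OF f]) auto
  thus ?case using Suc by simp
qed simp

lemma integral_mono_interval:
  fixes f :: "real \<Rightarrow> real"
  assumes f: "continuous_on {-1..1} f" and nn: "\<And>x. x \<in> {-1..1} \<Longrightarrow> 0 \<le> f x"
    and "-1 \<le> c" "d \<le> 1"
  shows "integral {c..d} f \<le> integral {-1..1} f"
  using assms by (intro integral_subset_le integrable_continuous_real continuous_on_subset[OF f]) auto

lemma recip_simps [simp]: "recip (ereal r) = 1 / r" "recip \<infinity> = 0"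
  by (simp_all add: recip_def one_ereal_def)

lemma Lq_norm_nonneg: "0 < q \<Longrightarrow> continuous_on {-1..1} f \<Longrightarrow> 0 \<le> Lq_norm q f"
proof (cases q)
  case PInf
  assume f: "continuous_on {-1..1} f"
  have "bdd_above ((\<lambda>x. \<bar>f x\<bar>) ` {-1..1})"
    by (intro bounded_imp_bdd_above compact_imp_bounded compact_continuous_image continuous_intros f) auto
  hence "\<bar>f 0\<bar> \<le> (SUP x\<in>{-1..1}. \<bar>f x\<bar>)" by (intro cSUP_upper) auto
  thus ?thesis using PInf by (simp add: Lq_norm_def)
qed (auto simp: Lq_norm_def)

lemma Lq_norm_ge:
  assumes q: "0 < q" and f: "continuous_on {-1..1} f" and cd: "-1 \<le> c" "c < d" "d \<le> 1"
    and b: "0 \<le> b" "\<And>x. x \<in> {c..d} \<Longrightarrow> b \<le> \<bar>f x\<bar>"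
  shows "b * (d - c) powr recip q \<le> Lq_norm q f"
proof (cases q)
  case (real r)
  hence r: "0 < r" using q by simp
  have "b powr r * (d - c) \<le> integral {c..d} (\<lambda>x. \<bar>f x\<bar> powr r)"
    using r cd b by (intro integral_ge_const integrable_powr continuous_on_subset[OF f] powr_mono2) auto
  also have "\<dots> \<le> integral {-1..1} (\<lambda>x. \<bar>f x\<bar> powr r)"
    using r cd f by (intro integral_mono_interval continuous_on_abs_powr) auto
  finally have "(b powr r * (d - c)) powr (1/r) \<le> Lq_norm q f"
    using r f cd b real by (simp add: Lq_norm_real powr_mono2)
  thus ?thesis using r cd b real by (simp add: powr_mult powr_powr)
next
  case PInf
  have "bdd_above ((\<lambda>x. \<bar>f x\<bar>) ` {-1..1})"
    by (intro bounded_imp_bdd_above compact_imp_bounded compact_continuous_image continuous_intros f) auto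
  hence "\<bar>f c\<bar> \<le> (SUP x\<in>{-1..1}. \<bar>f x\<bar>)" using cd by (intro cSUP_upper) auto
  moreover have "b \<le> \<bar>f c\<bar>" using b cd by simp
  ultimately show ?thesis using PInf cd by (simp add: Lq_norm_def)
qed (use q in auto)

text \<open>A concave power lies below its tangent at \<open>t\<close>. Taking for \<open>t\<close> the mean of the values gives Jensen's
  inequality, both for integrals (\<open>integral_powr_concave\<close>) and for sums (\<open>sum_powr_concave\<close>).\<close>

lemma powr_tangent:
  fixes x t s :: real
  assumes "0 \<le> x" "0 < t" "0 < s" "s \<le> 1"
  shows "x powr s \<le> (1 - s) * t powr s + s * t powr (s - 1) * x"
proof -
  have "x powr s * t powr (1 - s) \<le> s * x + (1 - s) * t"
    using assms Youngs_inequality_0[of s "1 - s" x t] by (cases "x = 0") auto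
  hence "x powr s * t powr (1 - s) * t powr (s - 1) \<le> (s * x + (1 - s) * t) * t powr (s - 1)"
    by (rule mult_right_mono) simp
  moreover have "t powr (1 - s) * t powr (s - 1) = 1" "t * t powr (s - 1) = t powr s"
    using assms by (simp_all flip: powr_add) (simp add: powr_diff)
  ultimately show ?thesis by (simp add: algebra_simps)
qed

lemma integral_powr_concave:
  fixes f :: "real \<Rightarrow> real"
  assumes f: "continuous_on {a..b} f" and nn: "\<And>x. x \<in> {a..b} \<Longrightarrow> 0 \<le> f x"
    and ab: "a < b" and s: "0 < s" "s \<le> 1"
  shows "integral {a..b} (\<lambda>x. \<bar>f x\<bar> powr s) \<le> (b - a) powr (1 - s) * (integral {a..b} f) powr s"
proof -
  define I where "I = integral {a..b} f"
  have int: "f integrable_on {a..b}" using f by (rule integrable_continuous_real)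
  have "0 \<le> I" unfolding I_def using nn int by (intro integral_nonneg) auto
  show ?thesis
  proof (cases "I = 0")
    case True
    have "(f has_integral 0) {a..b}" using int True by (simp add: I_def has_integral_iff)
    hence "f x = 0" if "x \<in> {a..b}" for x
      using has_integral_0_cbox_imp_0[of a b f] f nn ab that by (auto simp: box_real cbox_interval)
    hence "integral {a..b} (\<lambda>x. \<bar>f x\<bar> powr s) = integral {a..b} (\<lambda>x. 0)"
      by (intro integral_cong) auto
    thus ?thesis by simp
  next
    case False
    define t where "t = I / (b - a)"
    have t: "0 < t" using False \<open>0 \<le> I\<close> ab by (simp add: t_def)
    have "integral {a..b} (\<lambda>x. \<bar>f x\<bar> powr s)
        \<le> integral {a..b} (\<lambda>x. (1 - s) * t powr s + s * t powr (s - 1) * f x)"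
      using s f int nn t powr_tangent[of _ t s]
      by (intro integral_le integrable_powr integrable_continuous_real continuous_intros) auto
    also have "\<dots> = integral {a..b} (\<lambda>x. (1 - s) * t powr s) + integral {a..b} (\<lambda>x. s * t powr (s - 1) * f x)"
      by (intro Henstock_Kurzweil_Integration.integral_add integrable_continuous_real continuous_intros f)
    also have "\<dots> = (b - a) * ((1 - s) * t powr s) + s * t powr (s - 1) * I"
      using ab by (simp add: I_def)
    also have "I = t * (b - a)" using ab by (simp add: t_def)
    also have "s * t powr (s - 1) * (t * (b - a)) = s * (t powr (s - 1) * t) * (b - a)" by simp
    also have "t powr (s - 1) * t = t powr s" using t by (simp add: powr_diff)
    also have "(b - a) * ((1 - s) * t powr s) + s * t powr s * (b - a) = (b - a) * t powr s"
      by (simp add: algebra_simps)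
    also have "\<dots> = (b - a) powr (1 - s) * I powr s"
      using ab \<open>0 \<le> I\<close> by (simp add: t_def powr_divide powr_diff)
    finally show ?thesis by (simp add: I_def)
  qed
qed

lemma sum_powr_concave:
  fixes b :: "nat \<Rightarrow> real"
  assumes nn: "\<And>i. i < L \<Longrightarrow> 0 \<le> b i" and S: "(\<Sum>i<L. b i) \<le> S" and L: "0 < L"
    and s: "0 < s" "s \<le> 1"
  shows "(\<Sum>i<L. b i powr s) \<le> real L powr (1 - s) * S powr s"
proof (cases "S \<le> 0")
  case True
  have "(\<Sum>i<L. b i) = 0"
    using True S nn by (intro antisym sum_nonneg) auto
  hence "b i = 0" if "i < L" for i using nn that by (subst (asm) sum_nonneg_eq_0_iff) auto
  hence "(\<Sum>i<L. b i powr s) = 0" by simp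
  thus ?thesis by simp
next
  case False
  define t where "t = S / real L"
  have t: "0 < t" using False L by (simp add: t_def)
  have "(\<Sum>i<L. b i powr s) \<le> (\<Sum>i<L. (1 - s) * t powr s + s * t powr (s - 1) * b i)"
    using nn t s by (intro sum_mono powr_tangent) auto
  also have "\<dots> = real L * ((1 - s) * t powr s) + s * t powr (s - 1) * (\<Sum>i<L. b i)"
    by (simp add: sum.distrib sum_distrib_left)
  also have "\<dots> \<le> real L * ((1 - s) * t powr s) + s * t powr (s - 1) * S"
    using S s by (intro add_left_mono mult_left_mono) auto
  also have "S = t * real L" using L by (simp add: t_def)
  also have "s * t powr (s - 1) * (t * real L) = s * (t powr (s - 1) * t) * real L" by simp
  also have "t powr (s - 1) * t = t powr s" using t by (simp add: powr_diff)
  also have "real L * ((1 - s) * t powr s) + s * t powr s * real L = real L * t powr s"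
    by (simp add: algebra_simps)
  also have "\<dots> = real L powr (1 - s) * S powr s"
    using L False by (simp add: t_def powr_divide powr_diff)
  finally show ?thesis .
qed

lemma recip_nonneg: "0 < p \<Longrightarrow> 0 \<le> recip p"
  by (cases p) auto

lemma square_powr:
  fixes x :: real
  assumes "0 < x"
  shows "(x\<^sup>2) powr a = x powr (2 * a)"
proof -
  have "x\<^sup>2 = x powr 2" using assms by simp
  thus ?thesis by (simp only: powr_powr)
qed

lemma four_power: "(4::real) ^ i = (real (2 ^ i))\<^sup>2"
  by (simp add: power2_eq_square flip: power_mult_distrib)

section \<open>Absolutely monotone polynomials near the endpoint\<close>

text \<open>Nonnegativity is stated for the formal derivatives, so that no derivative functions have to be
  chosen. With \<open>k \<ge> 1\<close> the polynomial itself is increasing, and with \<open>n \<ge> 1\<close> the length \<open>n\<^bsup>-2\<^esup>\<close> makes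
  sense.\<close>

locale abs_mono_poly =
  fixes P :: "real poly" and k n :: nat
  assumes deg: "degree P \<le> n" and n_pos: "1 \<le> n" and k_pos: "1 \<le> k"
    and nonneg: "\<And>j x. j \<le> k \<Longrightarrow> x \<in> {-1..1} \<Longrightarrow> 0 \<le> poly ((pderiv ^^ j) P) x"
begin

lemma deriv_mono:
  assumes "j < k" "-1 \<le> x" "x \<le> y" "y \<le> 1"
  shows "poly ((pderiv ^^ j) P) x \<le> poly ((pderiv ^^ j) P) y"
proof (rule DERIV_nonneg_imp_nondecreasing[of x y])
  fix u assume "x \<le> u" "u \<le> y"
  thus "\<exists>d. (poly ((pderiv ^^ j) P) has_real_derivative d) (at u) \<and> 0 \<le> d"
    using assms nonneg[of "Suc j" u] by (intro exI[of _ "poly ((pderiv ^^ Suc j) P) u"]) (auto intro: poly_DERIV)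
qed fact

lemma abs_le_value_at_one:
  assumes "j < k" "x \<in> {-1..1}"
  shows "\<bar>poly ((pderiv ^^ j) P) x\<bar> \<le> poly ((pderiv ^^ j) P) 1"
  using nonneg[of j x] deriv_mono[of j x 1] assms by auto

lemma higher_deriv_le:
  assumes "x \<in> {-1..1}"
  shows "\<bar>poly ((pderiv ^^ j) P) x\<bar> \<le> (8 * (real n)\<^sup>2) ^ j * poly P 1"
  using higher_markov_inequality[OF deg, of "poly P 1" x j] abs_le_value_at_one[of 0] k_pos assms by auto

text \<open>A nonnegative increasing polynomial stays above half its maximum \<open>P(1)\<close> on an interval of length
  \<open>1 / (16 n\<^sup>2)\<close>, which already accounts for that much norm.\<close>

lemma value_at_one_le_norm:
  assumes p: "0 < p"
  shows "poly P 1 \<le> 2 * (16 * (real n)\<^sup>2) powr recip p * Lq_norm p (poly P)"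
proof -
  define c where "c = 1 - 1 / (16 * (real n)\<^sup>2)"
  have n2: "1 \<le> (real n)\<^sup>2" using n_pos by simp
  have "0 < 1 / (16 * (real n)\<^sup>2)" using n_pos by simp
  moreover have "1 / (16 * (real n)\<^sup>2) \<le> 1" using n2 n_pos by (subst divide_le_eq_1_pos, simp, linarith)
  ultimately have c: "-1 \<le> c" "c < 1" unfolding c_def by linarith+
  have P0: "0 \<le> poly P 1" using nonneg[of 0 1] by simp
  have "poly P 1 / 2 * (1 - c) powr recip p \<le> Lq_norm p (poly P)"
  proof (rule Lq_norm_ge[OF p])
    fix x assume "x \<in> {c..1}"
    hence "poly P 1 / 2 \<le> poly P x"
      using poly_ge_half_near_one[OF deg n_pos, of "poly P 1" x] abs_le_value_at_one[of 0] k_pos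
      by (auto simp: c_def)
    thus "poly P 1 / 2 \<le> \<bar>poly P x\<bar>" by simp
  qed (use c P0 in \<open>auto intro: continuous_intros\<close>)
  moreover have "(1 - c) powr recip p = 1 / (16 * (real n)\<^sup>2) powr recip p"
    by (simp add: c_def powr_divide)
  ultimately show ?thesis using n2 n_pos by (simp add: field_simps)
qed

text \<open>With \<open>E = P\<^sup>(\<^sup>m\<^sup>-\<^sup>1\<^sup>)(1)\<close>, the function \<open>P\<^sup>(\<^sup>m\<^sup>)\<close> has integral at most \<open>E\<close> and maximum at most \<open>8 n\<^sup>2 E\<close>.
  Interpolating between these two bounds gives the \<open>L\<^sub>q\<close> norm for \<open>q \<ge> 1\<close>, and \<open>m - 1\<close> further
  applications of Markov's inequality reduce \<open>E\<close> to \<open>P(1)\<close>.\<close>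

lemma norm_deriv_le_of_ge_one:
  assumes p: "0 < p" and q: "1 \<le> q" and m: "1 \<le> m" "m \<le> k"
  shows "Lq_norm q (poly ((pderiv ^^ m) P))
    \<le> (8 * (real n)\<^sup>2) powr (real m - recip q) * (2 * (16 * (real n)\<^sup>2) powr recip p * Lq_norm p (poly P))"
proof -
  define W where "W = 8 * (real n)\<^sup>2"
  have W: "0 < W" using n_pos by (simp add: W_def)
  obtain l where l: "m = Suc l" using m by (cases m) auto
  define Q where "Q = (pderiv ^^ l) P"
  have Q': "(pderiv ^^ m) P = pderiv Q" by (simp add: l Q_def)
  define E where "E = poly Q 1"
  have P0: "0 \<le> poly P 1" using nonneg[of 0 1] by simp
  have E0: "0 \<le> E" using nonneg[of l 1] m l by (simp add: E_def Q_def)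
  have E_le: "E \<le> W ^ l * poly P 1"
    using higher_deriv_le[of 1 l] by (simp add: E_def Q_def W_def)
  have sup: "\<bar>poly (pderiv Q) x\<bar> \<le> W * E" if "x \<in> {-1..1}" for x
    unfolding W_def E_def
    by (rule markov_inequality[OF _ _ that])
       (use abs_le_value_at_one[of l] m l deg in \<open>auto simp: Q_def degree_higher_pderiv\<close>)
  have nn: "0 \<le> poly (pderiv Q) x" if "x \<in> {-1..1}" for x
    using nonneg[of m x] m that by (simp add: Q')
  have "Lq_norm q (poly (pderiv Q)) \<le> W powr (1 - recip q) * E"
  proof (cases q)
    case PInf
    have "(SUP x\<in>{-1..1}. \<bar>poly (pderiv Q) x\<bar>) \<le> W * E"
      using sup by (intro cSUP_least) auto
    thus ?thesis using PInf W by (simp add: Lq_norm_def)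
  next
    case (real r)
    hence r: "1 \<le> r" using q by simp
    have hi: "(poly (pderiv Q) has_integral poly Q 1 - poly Q (-1)) {-1..1}"
      by (intro fundamental_theorem_of_calculus)
         (auto intro!: DERIV_subset[OF poly_DERIV] simp flip: has_real_derivative_iff_has_vector_derivative)
    have "integral {-1..1} (\<lambda>x. \<bar>poly (pderiv Q) x\<bar> powr r)
        \<le> integral {-1..1} (\<lambda>x. (W * E) powr (r - 1) * poly (pderiv Q) x)"
    proof (rule integral_le)
      fix x :: real assume x: "x \<in> {-1..1}"
      have "\<bar>poly (pderiv Q) x\<bar> powr r = \<bar>poly (pderiv Q) x\<bar> powr (r - 1) * \<bar>poly (pderiv Q) x\<bar>"
        by (cases "poly (pderiv Q) x = 0") (auto simp: powr_diff)
      also have "\<dots> \<le> (W * E) powr (r - 1) * \<bar>poly (pderiv Q) x\<bar>"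
        using sup[OF x] r by (intro mult_right_mono powr_mono2) auto
      finally show "\<bar>poly (pderiv Q) x\<bar> powr r \<le> (W * E) powr (r - 1) * poly (pderiv Q) x"
        using nn[OF x] by simp
    next
      show "(\<lambda>x. \<bar>poly (pderiv Q) x\<bar> powr r) integrable_on {-1..1}"
        using r by (intro integrable_powr continuous_intros) auto
      show "(\<lambda>x. (W * E) powr (r - 1) * poly (pderiv Q) x) integrable_on {-1..1}"
        by (intro integrable_continuous_real continuous_intros)
    qed
    also have "\<dots> = (W * E) powr (r - 1) * (poly Q 1 - poly Q (-1))"
      using hi by (simp add: integral_unique)
    also have "\<dots> \<le> (W * E) powr (r - 1) * E"
      using nonneg[of l "-1"] m l by (intro mult_left_mono) (auto simp: E_def Q_def)
    also have "\<dots> = W powr (r - 1) * E powr r"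
      using W E0 by (cases "E = 0") (auto simp: powr_mult powr_diff)
    finally have "Lq_norm q (poly (pderiv Q)) \<le> (W powr (r - 1) * E powr r) powr (1 / r)"
      unfolding real using r by (subst Lq_norm_real) (auto intro!: powr_mono2 integral_nonneg integrable_powr continuous_intros)
    also have "\<dots> = W powr (1 - recip q) * E"
      using r W E0 real by (simp add: powr_mult powr_powr diff_divide_distrib)
    finally show ?thesis .
  qed (use q in auto)
  also have "\<dots> \<le> W powr (1 - recip q) * (W ^ l * poly P 1)"
    using E_le by (intro mult_left_mono) auto
  also have "\<dots> = W powr (real m - recip q) * poly P 1"
    using W by (simp add: l flip: powr_realpow powr_add) (simp add: powr_add powr_diff)
  also have "\<dots> \<le> W powr (real m - recip q) * (2 * (16 * (real n)\<^sup>2) powr recip p * Lq_norm p (poly P))"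
    using value_at_one_le_norm[OF p] by (intro mult_left_mono) auto
  finally show ?thesis by (simp add: Q' W_def)
qed

text \<open>The Taylor polynomial of \<open>P\<close> of order \<open>l\<close> with centre \<open>x\<close>, evaluated at \<open>y\<close>. It is studied as a function
  of its centre: in \<open>x\<close> it is increasing, because all terms of its derivative but one cancel, and at
  \<open>x = y\<close> it equals \<open>P(y)\<close>.\<close>

definition taylor :: "nat \<Rightarrow> real \<Rightarrow> real \<Rightarrow> real" where
  "taylor l y x = (\<Sum>j\<le>l. poly ((pderiv ^^ j) P) x * (y - x) ^ j / fact j)"

lemma taylor_deriv:
  "(taylor l y has_real_derivative poly ((pderiv ^^ Suc l) P) x * (y - x) ^ l / fact l) (at x)"
proof (induction l)
  case 0
  show ?case unfolding taylor_def by (auto intro!: derivative_eq_intros)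
next
  case (Suc l)
  let ?D = "\<lambda>j. poly ((pderiv ^^ j) P)"
  have eq: "taylor (Suc l) y = (\<lambda>x. taylor l y x + ?D (Suc l) x * (y - x) ^ Suc l / fact (Suc l))"
    by (simp add: taylor_def fun_eq_iff)
  have f: "fact (Suc l) = real (Suc l) * fact l" by simp
  have d: "(?D (Suc l) has_real_derivative ?D (Suc (Suc l)) x) (at x)"
    using poly_DERIV[of "(pderiv ^^ Suc l) P" x] by simp
  have "((\<lambda>x. taylor l y x + ?D (Suc l) x * (y - x) ^ Suc l / fact (Suc l)) has_real_derivative
      ?D (Suc l) x * (y - x) ^ l / fact l +
      (?D (Suc (Suc l)) x * (y - x) ^ Suc l + (real (Suc l) * (y - x) ^ l * (0 - 1)) * ?D (Suc l) x) / fact (Suc l)) (at x)"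
    by (rule derivative_eq_intros refl Suc d | simp)+
  also have "?D (Suc l) x * (y - x) ^ l / fact l +
      (?D (Suc (Suc l)) x * (y - x) ^ Suc l + (real (Suc l) * (y - x) ^ l * (0 - 1)) * ?D (Suc l) x) / fact (Suc l)
      = ?D (Suc (Suc l)) x * (y - x) ^ Suc l / fact (Suc l)"
    unfolding f add_divide_distrib by (simp add: divide_simps)
  finally show ?case unfolding eq .
qed

lemma taylor_diff_has_integral:
  assumes "a \<le> b"
  shows "((\<lambda>x. poly ((pderiv ^^ Suc l) P) x * (y - x) ^ l / fact l) has_integral taylor l y b - taylor l y a) {a..b}"
  using assms
  by (intro fundamental_theorem_of_calculus)
     (auto intro!: DERIV_subset[OF taylor_deriv] simp del: funpow.simps simp flip: has_real_derivative_iff_has_vector_derivative)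

lemma taylor_mono:
  assumes "Suc l \<le> k" "-1 \<le> a" "a \<le> b" "b \<le> y" "y \<le> 1"
  shows "taylor l y a \<le> taylor l y b"
proof -
  have "0 \<le> taylor l y b - taylor l y a"
    by (rule has_integral_nonneg[OF taylor_diff_has_integral])
       (use assms nonneg[of "Suc l"] in \<open>auto simp del: funpow.simps\<close>)
  thus ?thesis by simp
qed

lemma taylor_diag: "taylor l y y = poly P y"
  by (simp add: taylor_def sum.atMost_shift)

lemma taylor_nonneg:
  assumes "l \<le> k" "-1 \<le> x" "x \<le> y" "y \<le> 1"
  shows "0 \<le> taylor l y x"
  unfolding taylor_def using assms nonneg by (intro sum_nonneg) auto

text \<open>This is how nonnegativity of the derivatives controls \<open>P\<^sup>(\<^sup>l\<^sup>+\<^sup>1\<^sup>)\<close> by \<open>P\<close> without a pointwise bound: the top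
  derivative need not be monotone, but its integral against \<open>(y - x)\<^sup>l\<close> is a difference of Taylor
  polynomials.\<close>

lemma integral_deriv_le_taylor_diff:
  assumes "Suc l \<le> k" "-1 \<le> a" "a \<le> b" "b \<le> y" "y \<le> 1"
  shows "(y - b) ^ l * integral {a..b} (poly ((pderiv ^^ Suc l) P)) \<le> fact l * (taylor l y b - taylor l y a)"
proof -
  let ?f = "poly ((pderiv ^^ Suc l) P)"
  have "integral {a..b} (\<lambda>x. (y - b) ^ l / fact l * ?f x) \<le> taylor l y b - taylor l y a"
    unfolding integral_unique[OF taylor_diff_has_integral[OF assms(3)], symmetric]
  proof (rule integral_le)
    fix x assume x: "x \<in> {a..b}"
    have "(y - b) ^ l \<le> (y - x) ^ l" using x assms by (intro power_mono) auto
    thus "(y - b) ^ l / fact l * ?f x \<le> ?f x * (y - x) ^ l / fact l"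
      using nonneg[of "Suc l" x] x assms
      by (simp add: divide_simps mult_right_mono mult.commute[of "?f x"] del: funpow.simps)
  qed (auto intro!: integrable_continuous_real continuous_intros)
  hence "(y - b) ^ l / fact l * integral {a..b} ?f \<le> taylor l y b - taylor l y a"
    by (simp del: funpow.simps)
  thus ?thesis by (simp add: field_simps del: funpow.simps)
qed

end

section \<open>Upper bounds on dyadic shells\<close>

text \<open>The order of \<open>\<Sum>\<^sub>i\<^sub><\<^sub>L 4\<^bsup>ie\<^esup> A\<^sub>i\<^sup>q\<close>: the last term decides for \<open>e > 0\<close>, the first for \<open>e < 0\<close>, and for
  \<open>e = 0\<close> the number of terms to a power \<open>\<sigma>\<close> that depends on the summability of \<open>A\<close>.\<close>

definition weight_rate :: "real \<Rightarrow> real \<Rightarrow> nat \<Rightarrow> real" where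
  "weight_rate e \<sigma> L = (if e > 0 then (4 ^ L) powr e else if e = 0 then real L powr \<sigma> else 1)"

text \<open>For \<open>e \<noteq> 0\<close> the weights form a geometric series and each \<open>A\<^sub>i\<close> may be replaced by the bound \<open>D\<close>. For
  \<open>e = 0\<close> that would cost a factor \<open>L\<close>, and concavity of the power \<open>q / r\<close> reduces it to \<open>L\<^bsup>1-q/r\<^esup>\<close>.\<close>

lemma weighted_sum_le_rate:
  assumes q: "0 < q" and r: "0 < r" and qr: "e = 0 \<Longrightarrow> q \<le> r"
  shows "\<exists>C>0. \<forall>L A D. 1 \<le> L \<longrightarrow> 0 \<le> D \<longrightarrow> (\<forall>i<L. 0 \<le> A i) \<longrightarrow> (\<Sum>i<L. A i powr r) \<le> D powr r \<longrightarrow>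
     (\<Sum>i<L. (4 ^ i) powr e * A i powr q) \<le> C * weight_rate e (1 - q / r) L * D powr q"
proof -
  define x :: real where "x = 4 powr e"
  have x4: "((4::real) ^ i) powr e = x ^ i" for i
    by (simp add: x_def powr_powr powr_power flip: powr_realpow) (simp add: mult.commute)
  have x0: "0 < x" by (simp add: x_def)
  have single: "A i powr q \<le> D powr q"
    if "0 \<le> D" "\<forall>i<L. 0 \<le> A i" "(\<Sum>i<L. A i powr r) \<le> D powr r" "i < L" for A D L and i :: nat
  proof -
    have A: "0 \<le> A i" using that by blast
    have "A i powr r \<le> (\<Sum>i<L. A i powr r)" using that by (intro member_le_sum) auto
    hence "A i powr r \<le> D powr r" using that by simp
    hence "(A i powr r) powr (1/r) \<le> (D powr r) powr (1/r)" 
      by (rule powr_mono2[rotated 2]) (use r in auto)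
    hence "A i \<le> D" using that(1) A r by (simp add: powr_powr)
    thus ?thesis using A q by (intro powr_mono2) auto
  qed
  have sum_le: "(\<Sum>i<L. (4 ^ i) powr e * A i powr q) \<le> (\<Sum>i<L. x ^ i) * D powr q"
    if "0 \<le> D" "\<forall>i<L. 0 \<le> A i" "(\<Sum>i<L. A i powr r) \<le> D powr r" for A D L
    unfolding sum_distrib_right x4 using single[OF that] x0 by (intro sum_mono mult_left_mono) auto
  consider "e > 0" | "e = 0" | "e < 0" by linarith
  thus ?thesis
  proof cases
    case 1
    hence x1: "1 < x" by (simp add: x_def)
    have geo: "(\<Sum>i<L. x ^ i) \<le> 1 / (x - 1) * x ^ L" for L
      using x1 by (subst geometric_sum) (auto simp: divide_simps)
    have "(\<Sum>i<L. (4 ^ i) powr e * A i powr q) \<le> 1 / (x - 1) * weight_rate e (1 - q / r) L * D powr q"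
      if "0 \<le> D" "\<forall>i<L. 0 \<le> A i" "(\<Sum>i<L. A i powr r) \<le> D powr r" for A D L
    proof -
      have "(\<Sum>i<L. (4 ^ i) powr e * A i powr q) \<le> (\<Sum>i<L. x ^ i) * D powr q"
        by (rule sum_le[OF that])
      also have "\<dots> \<le> (1 / (x - 1) * x ^ L) * D powr q"
        by (intro mult_right_mono geo) auto
      finally show ?thesis using 1 by (simp add: weight_rate_def x4)
    qed
    thus ?thesis using x1 by (intro exI[of _ "1 / (x - 1)"]) auto
  next
    case 3
    hence x1: "x < 1" unfolding x_def using powr_less_cancel_iff[of 4 e 0] by simp
    have "(\<Sum>i<L. x ^ i) \<le> 1 / (1 - x)" for L
    proof -
      have "(\<Sum>i<L. x ^ i) = (1 - x ^ L) / (1 - x)"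
        using x1 by (simp add: sum_gp_strict)
      thus ?thesis using x1 x0 by (simp add: divide_right_mono)
    qed
    hence "(\<Sum>i<L. (4 ^ i) powr e * A i powr q) \<le> 1 / (1 - x) * weight_rate e (1 - q / r) L * D powr q"
      if "0 \<le> D" "\<forall>i<L. 0 \<le> A i" "(\<Sum>i<L. A i powr r) \<le> D powr r" for A D L
      using 3 unfolding weight_rate_def
      by (auto intro!: order_trans[OF sum_le[OF that]] mult_right_mono simp del: times_divide_eq_left)
    thus ?thesis using x1 by (intro exI[of _ "1 / (1 - x)"]) auto
  next
    case 2
    have "(\<Sum>i<L. (4 ^ i) powr e * A i powr q) \<le> 1 * weight_rate e (1 - q / r) L * D powr q"
      if L: "1 \<le> L" and D: "0 \<le> D" "\<forall>i<L. 0 \<le> A i" "(\<Sum>i<L. A i powr r) \<le> D powr r" for A D L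
    proof -
      have "(\<Sum>i<L. (A i powr r) powr (q / r)) \<le> real L powr (1 - q / r) * (D powr r) powr (q / r)"
        using L D q r qr 2 by (intro sum_powr_concave) auto
      thus ?thesis using 2 r by (simp add: weight_rate_def powr_powr)
    qed
    thus ?thesis by (intro exI[of _ 1]) auto
  qed
qed

context abs_mono_poly
begin

text \<open>On a shell of length comparable to \<open>4\<^bsup>-i\<^esup>\<close>, concavity of the \<open>q\<close>-th power replaces the integral of the
  power by the power of the integral, which costs the factor \<open>4\<^bsup>-i(1-q)\<^esup>\<close>.\<close>

lemma shell_integral_le:
  assumes m: "Suc l \<le> k" and q: "0 < q" "q \<le> 1" and F: "0 \<le> F" and A: "0 \<le> A"
    and I: "integral {1 - 2/4^i .. 1 - 2/4^Suc i} (poly ((pderiv ^^ Suc l) P)) \<le> F * (4^i) ^ l * (4^i) powr \<alpha> * A"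
  shows "integral {1 - 2/4^i .. 1 - 2/4^Suc i} (\<lambda>x. \<bar>poly ((pderiv ^^ Suc l) P) x\<bar> powr q)
    \<le> (3/2) powr (1 - q) * F powr q * ((4 ^ i) powr (q * (real (Suc l) + \<alpha>) - 1) * A powr q)"
proof -
  let ?f = "poly ((pderiv ^^ Suc l) P)"
  define z :: real where "z = 4 ^ i"
  have z: "1 \<le> z" by (simp add: z_def)
  let ?a = "1 - 2/4^i :: real" and ?b = "1 - 2/4^Suc i :: real"
  have ab: "?b - ?a = 3/2 / z" "?a < ?b" "-1 \<le> ?a" "?b \<le> 1"
    using z by (auto simp: z_def divide_simps)
  have nn: "0 \<le> ?f x" if "x \<in> {?a..?b}" for x
    using nonneg[of "Suc l" x] m that ab by auto
  have "integral {?a..?b} (\<lambda>x. \<bar>?f x\<bar> powr q) \<le> (?b - ?a) powr (1 - q) * (integral {?a..?b} ?f) powr q"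
    using nn ab q by (intro integral_powr_concave continuous_intros) auto
  also have "\<dots> \<le> (3/2 / z) powr (1 - q) * (F * z ^ l * z powr \<alpha> * A) powr q"
    using I q nn unfolding ab
    by (intro mult_left_mono powr_mono2 integral_nonneg integrable_continuous_real continuous_intros)
       (auto simp: z_def)
  also have "\<dots> = (3/2) powr (1 - q) * F powr q * (z powr (q - 1) * z powr (l * q) * z powr (\<alpha> * q) * A powr q)"
    using z F A by (simp add: powr_mult powr_divide powr_powr powr_diff mult_ac flip: powr_realpow)
  also have "z powr (q - 1) * z powr (l * q) * z powr (\<alpha> * q) = z powr (q * (real (Suc l) + \<alpha>) - 1)"
    by (simp add: algebra_simps flip: powr_add)
  finally show ?thesis by (simp only: z_def)
qed

text \<open>The coefficient of shell \<open>i\<close> is the value of \<open>P\<close> at distance \<open>4\<^bsup>-i\<^esup>/4\<close> from \<open>1\<close>, normalised so that its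
  \<open>p\<close>-th power is, up to a constant, at most the integral of \<open>P\<^sup>p\<close> over the shell that starts there:
  \<open>P\<close> increases. Those shells are adjacent, hence the bound for the sum.\<close>

lemma shell_coefficients_finite:
  assumes m: "Suc l \<le> k" and p: "0 < p"
  defines "A \<equiv> \<lambda>i. (1/4^i) powr (1/p) * poly P (1 - 1/4/4^i)"
  shows "0 \<le> A i"
    and "integral {1 - 2/4^i .. 1 - 2/4^Suc i} (poly ((pderiv ^^ Suc l) P))
      \<le> (fact l * 4 ^ l) * (4^i) ^ l * (4^i) powr (1/p) * A i"
    and "(\<Sum>i<L. A i powr p) \<le> ((16/3) powr (1/p) * Lq_norm (ereal p) (poly P)) powr p"
proof -
  have z: "(1::real) \<le> 4 ^ i" for i by simp
  have y: "-1 \<le> 1 - 1/4/(4::real)^i" "1 - 1/4/4^i \<le> (1::real)" for i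
  proof -
    have "1 \<le> 8 * (4::real) ^ i" using z[of i] by linarith
    thus "-1 \<le> 1 - 1/4/(4::real)^i" "1 - 1/4/4^i \<le> (1::real)" by (auto simp: divide_simps)
  qed
  have P0: "0 \<le> poly P x" if "x \<in> {-1..1}" for x using nonneg[of 0 x] that by simp
  show A0: "0 \<le> A i" for i unfolding A_def using P0 y by simp
  show "integral {1 - 2/4^i .. 1 - 2/4^Suc i} (poly ((pderiv ^^ Suc l) P))
      \<le> (fact l * 4 ^ l) * (4^i) ^ l * (4^i) powr (1/p) * A i" (is "?I \<le> _")
  proof -
    let ?a = "1 - 2/4^i :: real" and ?b = "1 - 2/4^Suc i :: real" and ?y = "1 - 1/4/4^i :: real"
    have o: "-1 \<le> ?a" "?a \<le> ?b" "?b \<le> ?y" using z[of i] by (auto simp: divide_simps)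
    have "(?y - ?b) ^ l * ?I \<le> fact l * (taylor l ?y ?b - taylor l ?y ?a)"
      by (rule integral_deriv_le_taylor_diff[OF m o y(2)])
    also have "\<dots> \<le> fact l * poly P ?y"
      using taylor_mono[OF m _ o(3) order_refl y(2)] taylor_nonneg[of l ?a ?y] taylor_diag[of l ?y] o m y
      by (intro mult_left_mono) auto
    finally have "(1 / (4 * 4^i)) ^ l * ?I \<le> fact l * poly P ?y" by simp
    hence "?I \<le> (4 * 4^i) ^ l * (fact l * poly P ?y)" by (simp add: power_divide divide_simps mult.commute)
    also have "poly P ?y = (4^i) powr (1/p) * A i"
      unfolding A_def by (simp add: powr_divide)
    finally show ?thesis by (simp add: power_mult_distrib mult_ac)
  qed
  have "(\<Sum>i<L. A i powr p) \<le> (\<Sum>i<L. 16/3 * integral {1 - 1/4/4^i .. 1 - 1/4/4^Suc i} (\<lambda>x. \<bar>poly P x\<bar> powr p))"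
  proof (rule sum_mono)
    fix i
    let ?a = "1 - 1/4/4^i :: real" and ?b = "1 - 1/4/4^Suc i :: real"
    have o: "-1 \<le> ?a" "?a \<le> ?b" "?b \<le> 1" using y(1)[of i] y(2)[of "Suc i"] by (auto simp: divide_simps)
    have "poly P ?a powr p * (?b - ?a) \<le> integral {?a..?b} (\<lambda>x. \<bar>poly P x\<bar> powr p)"
    proof (rule integral_ge_const)
      fix x assume x: "x \<in> {?a..?b}"
      have "poly P ?a \<le> poly P x" using deriv_mono[of 0 ?a x] k_pos x o by auto
      thus "poly P ?a powr p \<le> \<bar>poly P x\<bar> powr p" using P0[of ?a] y p by (intro powr_mono2) auto
    qed (use o p in \<open>auto intro!: integrable_powr continuous_intros\<close>)
    moreover have "A i powr p = 16/3 * (poly P ?a powr p * (?b - ?a))"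
      using p P0[of ?a] y unfolding A_def by (simp add: powr_mult powr_powr)
    ultimately show "A i powr p \<le> 16/3 * integral {?a..?b} (\<lambda>x. \<bar>poly P x\<bar> powr p)" by linarith
  qed
  also have "\<dots> = 16/3 * integral {1 - 1/4 .. 1 - 1/4/4^L} (\<lambda>x. \<bar>poly P x\<bar> powr p)"
    using p by (subst sum_distrib_left[symmetric], subst integral_shells)
      (auto intro!: continuous_on_abs_powr continuous_on_poly)
  also have "\<dots> \<le> 16/3 * integral {-1..1} (\<lambda>x. \<bar>poly P x\<bar> powr p)"
    using p by (intro mult_left_mono integral_mono_interval continuous_on_powr' continuous_intros) auto
  also have "\<dots> = ((16/3) powr (1/p) * Lq_norm (ereal p) (poly P)) powr p"
  proof -
    have "0 \<le> integral {-1..1} (\<lambda>x. \<bar>poly P x\<bar> powr p)"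
      using p by (intro integral_nonneg integrable_powr continuous_intros) auto
    thus ?thesis using p by (simp add: Lq_norm_real continuous_on_poly powr_mult powr_powr)
  qed
  finally show "(\<Sum>i<L. A i powr p) \<le> ((16/3) powr (1/p) * Lq_norm (ereal p) (poly P)) powr p" .
qed

text \<open>For \<open>p = \<infinity>\<close> the values of \<open>P\<close> are merely bounded, and would lose a full logarithm. The differences of the
  Taylor polynomial are summable instead, since they telescope to at most \<open>P(1)\<close>.\<close>

lemma shell_coefficients_infinite:
  assumes m: "Suc l \<le> k"
  defines "A \<equiv> \<lambda>i. taylor l 1 (1 - 2/4^Suc i) - taylor l 1 (1 - 2/4^i)"
  shows "0 \<le> A i"
    and "integral {1 - 2/4^i .. 1 - 2/4^Suc i} (poly ((pderiv ^^ Suc l) P))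
      \<le> (fact l * 4 ^ l) * (4^i) ^ l * A i"
    and "(\<Sum>i<L. A i) \<le> poly P 1"
proof -
  have z: "(1::real) \<le> 4 ^ i" for i by simp
  have o: "-1 \<le> 1 - 2/(4::real)^i" "1 - 2/4^i \<le> 1 - 2/(4::real)^Suc i" "1 - 2/4^i \<le> (1::real)" for i
    using z[of i] by (auto simp: divide_simps)
  show A0: "0 \<le> A i" for i unfolding A_def
    using taylor_mono[OF m o(1) o(2) o(3) order_refl, of i] by simp
  show "integral {1 - 2/4^i .. 1 - 2/4^Suc i} (poly ((pderiv ^^ Suc l) P))
      \<le> (fact l * 4 ^ l) * (4^i) ^ l * A i" (is "?I \<le> _")
  proof -
    have "(1 - (1 - 2/4^Suc i)) ^ l * ?I \<le> fact l * A i"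
      unfolding A_def by (rule integral_deriv_le_taylor_diff[OF m o(1) o(2) o(3) order_refl])
    hence "(1 / (2 * 4^i)) ^ l * ?I \<le> fact l * A i" by simp
    hence "?I \<le> (2 * 4^i) ^ l * (fact l * A i)" by (simp add: power_divide divide_simps mult.commute)
    also have "\<dots> \<le> (4 * 4^i) ^ l * (fact l * A i)"
      using A0 by (intro mult_right_mono power_mono) auto
    finally show ?thesis by (simp add: power_mult_distrib mult_ac)
  qed
  have "(\<Sum>i<L. A i) = taylor l 1 (1 - 2/4^L) - taylor l 1 (1 - 2/4^0)"
    unfolding A_def by (rule sum_lessThan_telescope)
  also have "\<dots> \<le> taylor l 1 1"
    using taylor_mono[OF m o(1) o(3) order_refl order_refl, of L] taylor_nonneg[of l "1 - 2/4^0" 1] m by simp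
  finally show "(\<Sum>i<L. A i) \<le> poly P 1" by (simp add: taylor_diag)
qed

end

text \<open>The exponent \<open>\<rho>\<close> for which the coefficients of the shells are \<open>1/\<rho>\<close>-summable. It makes
  \<open>\<beta> - \<rho>\<close> the power of the logarithm in the critical case for finite and for infinite \<open>p\<close>.\<close>

definition log_loss :: "ereal \<Rightarrow> real" where
  "log_loss p = (if p = \<infinity> then 1 else recip p)"

text \<open>A common form of the rates for finite and infinite \<open>p\<close>, with real exponents throughout.\<close>

definition markov_rate :: "ereal \<Rightarrow> ereal \<Rightarrow> nat \<Rightarrow> nat \<Rightarrow> real" where
  "markov_rate q p m n =
    (if real m > recip q - recip p then real n powr (2 * real m + 2 * recip p - 2 * recip q)
     else if real m = recip q - recip p then ln (real n) powr (recip q - log_loss p)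
     else 1)"

text \<open>The two constructions of coefficients under one statement. The factor \<open>2\<close> on the norm is the one of
  \<open>value_at_one_le_norm\<close> for \<open>p = \<infinity>\<close>.\<close>

lemma (in abs_mono_poly) shell_coefficients:
  assumes m: "Suc l \<le> k" and p: "0 < p"
  shows "\<exists>A. (\<forall>i. 0 \<le> A i)
    \<and> (\<forall>i. integral {1 - 2/4^i .. 1 - 2/4^Suc i} (poly ((pderiv ^^ Suc l) P))
      \<le> (fact l * 4 ^ l) * (4^i) ^ l * (4^i) powr recip p * A i)
    \<and> (\<forall>L. (\<Sum>i<L. A i powr (1 / log_loss p)) \<le> (2 * (16/3) powr recip p * Lq_norm p (poly P)) powr (1 / log_loss p))"
proof (cases p)
  case (real r)
  hence r: "0 < r" using p by simp
  have "(16/3) powr (1/r) * Lq_norm p (poly P) \<le> 2 * (16/3) powr (1/r) * Lq_norm p (poly P)"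
    using Lq_norm_nonneg[OF p continuous_on_poly[OF continuous_on_id], of P] by (simp add: mult_right_mono)
  hence "((16/3) powr (1/r) * Lq_norm p (poly P)) powr r \<le> (2 * (16/3) powr (1/r) * Lq_norm p (poly P)) powr r"
    using r Lq_norm_nonneg[OF p continuous_on_poly[OF continuous_on_id], of P] by (intro powr_mono2) auto
  moreover have "1 / log_loss p = r" using real r by (simp add: log_loss_def)
  ultimately show ?thesis
    using shell_coefficients_finite[OF m r] real
    by (intro exI[of _ "\<lambda>i. (1/4^i) powr (1/r) * poly P (1 - 1/4/4^i)"]) (auto intro: order_trans simp del: funpow.simps)
next
  case PInf
  have "0 \<le> Lq_norm p (poly P)"
    using Lq_norm_nonneg[OF p continuous_on_poly[OF continuous_on_id], of P] by simp
  moreover have "poly P 1 \<le> 2 * Lq_norm p (poly P)"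
    using value_at_one_le_norm[OF p] PInf n_pos by simp
  ultimately show ?thesis
    using shell_coefficients_infinite[OF m] PInf
    by (intro exI[of _ "\<lambda>i. taylor l 1 (1 - 2/4^Suc i) - taylor l 1 (1 - 2/4^i)"])
       (auto intro: order_trans simp: log_loss_def simp del: funpow.simps power_Suc)
qed (use p in auto)

text \<open>With \<open>2\<^sup>L \<le> n\<close>, the rate in the number \<open>L\<close> of shells becomes a rate in \<open>n\<close>. The second estimate is for
  the remaining interval next to \<open>1\<close>, of length about \<open>n\<^bsup>-2\<^esup>\<close>, which contributes \<open>n\<^bsup>2e\<^esup>\<close>.\<close>

lemma weight_rate_le:
  fixes e \<sigma> :: real
  assumes \<sigma>: "e = 0 \<Longrightarrow> 0 \<le> \<sigma>"
  defines "R \<equiv> \<lambda>n::nat. if e > 0 then real n powr (2 * e) else if e = 0 then ln (real n) powr \<sigma> else 1"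
  shows "\<exists>C>0. \<forall>L n. 1 \<le> L \<longrightarrow> 2 ^ L \<le> n \<longrightarrow> weight_rate e \<sigma> L \<le> C * R n \<and> real n powr (2 * e) \<le> C * R n"
proof -
  have *: "weight_rate e \<sigma> L \<le> (1 + (1 / ln 2) powr \<sigma>) * R n \<and> real n powr (2 * e) \<le> (1 + (1 / ln 2) powr \<sigma>) * R n"
    if L: "1 \<le> L" "2 ^ L \<le> n" for L n
  proof -
    have n: "2 ^ L \<le> real n" using L(2) by (metis of_nat_le_iff of_nat_numeral of_nat_power)
    have "(2::real) \<le> 2 ^ L" using power_increasing[of 1 L "2::real"] L(1) by simp
    hence n2: "2 \<le> real n" using n by linarith
    have R0: "0 \<le> R n" by (simp add: R_def)
    have w: "weight_rate e \<sigma> L \<le> R n" "real n powr (2 * e) \<le> R n" if "e > 0"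
    proof -
      have "(4::real) ^ L = (2 ^ L)\<^sup>2" by (simp add: power2_eq_square flip: power_mult_distrib)
      hence "((4::real) ^ L) powr e = (2 ^ L) powr (2 * e)" by (simp add: square_powr)
      also have "\<dots> \<le> real n powr (2 * e)" using n that by (intro powr_mono2) auto
      finally show "weight_rate e \<sigma> L \<le> R n" using that by (simp add: weight_rate_def R_def)
      show "real n powr (2 * e) \<le> R n" using that by (simp add: R_def)
    qed
    have z: "weight_rate e \<sigma> L \<le> (1 / ln 2) powr \<sigma> * R n" "real n powr (2 * e) \<le> (1 / ln 2) powr \<sigma> * R n" if "e = 0"
    proof -
      have "ln (2 ^ L) \<le> ln (real n)" using n n2 by simp
      hence L_le: "real L \<le> 1 / ln 2 * ln (real n)" by (simp add: ln_realpow divide_simps)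
      hence "real L powr \<sigma> \<le> (1 / ln 2 * ln (real n)) powr \<sigma>"
        using \<sigma> that by (intro powr_mono2) auto
      also have "\<dots> = (1 / ln 2) powr \<sigma> * R n" 
        by (subst powr_mult) (use n2 that in \<open>auto simp: R_def\<close>)
      finally show 1: "weight_rate e \<sigma> L \<le> (1 / ln 2) powr \<sigma> * R n" using that by (simp add: weight_rate_def)
      have "1 \<le> real L powr \<sigma>" using L(1) \<sigma> that by (simp add: ge_one_powr_ge_zero)
      thus "real n powr (2 * e) \<le> (1 / ln 2) powr \<sigma> * R n" using 1 that n2 by (simp add: weight_rate_def)
    qed
    have g: "weight_rate e \<sigma> L \<le> R n" "real n powr (2 * e) \<le> R n" if "e < 0"
    proof -
      show "weight_rate e \<sigma> L \<le> R n" using that by (simp add: weight_rate_def R_def)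
      have "real n powr (2 * e) \<le> real n powr 0" using n2 that by (intro powr_mono) auto
      thus "real n powr (2 * e) \<le> R n" using that n2 by (simp add: R_def)
    qed
    have "0 \<le> (1 / ln 2) powr \<sigma> * R n" using R0 by simp
    moreover have "(1 + (1 / ln 2) powr \<sigma>) * R n = R n + (1 / ln 2) powr \<sigma> * R n" by (simp add: algebra_simps)
    moreover consider "e > 0" | "e = 0" | "e < 0" by linarith
    hence "(weight_rate e \<sigma> L \<le> R n \<and> real n powr (2 * e) \<le> R n) \<or>
        (weight_rate e \<sigma> L \<le> (1 / ln 2) powr \<sigma> * R n \<and> real n powr (2 * e) \<le> (1 / ln 2) powr \<sigma> * R n)"
      by cases (use w z g in blast)+
    ultimately show ?thesis using R0 by linarith
  qed
  have "0 < 1 + (1 / ln 2) powr \<sigma>" by (simp add: add_pos_nonneg)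
  thus ?thesis using * by (intro exI[of _ "1 + (1 / ln 2) powr \<sigma>"]) blast
qed

text \<open>The inequality that makes the power \<open>q / r\<close> concave in the critical case, where \<open>1/r\<close> is the exponent
  \<open>log_loss p\<close>.\<close>

lemma critical_exponent_order:
  assumes "0 < p" "0 < q" "q \<le> 1" "1 \<le> m" "real m = 1 / q - recip p"
  shows "q \<le> 1 / log_loss p"
proof (cases p)
  case (real r)
  hence "1 / r \<le> 1 / q" using assms by simp
  thus ?thesis using real assms by (simp add: log_loss_def field_simps)
qed (use assms in \<open>auto simp: log_loss_def\<close>)

text \<open>The shells cover \<open>[-1, 1]\<close> up to distance \<open>2/4\<^sup>L\<close> from \<open>1\<close>, with \<open>L\<close> the binary logarithm of \<open>n\<close>. On the
  remaining interval Markov's inequality bounds \<open>P\<^sup>(\<^sup>m\<^sup>)\<close> pointwise.\<close>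

lemma norm_deriv_le_of_lt_one:
  fixes q :: real
  assumes p: "0 < p" and q: "0 < q" "q \<le> 1" and m: "1 \<le> m" "m \<le> k"
  shows "\<exists>C>0. \<forall>n P. 2 \<le> n \<longrightarrow> abs_mono_poly P k n \<longrightarrow>
    Lq_norm (ereal q) (poly ((pderiv ^^ m) P)) \<le> C * markov_rate (ereal q) p m n * Lq_norm p (poly P)"
proof -
  obtain l where l: "m = Suc l" using m by (cases m) auto
  define \<alpha> where "\<alpha> = recip p"
  define r where "r = 1 / log_loss p"
  define e where "e = q * (real m + \<alpha>) - 1"
  define \<sigma> where "\<sigma> = 1 - q / r"
  define R where "R = (\<lambda>n::nat. if e > 0 then real n powr (2 * e) else if e = 0 then ln (real n) powr \<sigma> else 1)"
  have \<alpha>: "0 \<le> \<alpha>" using p by (simp add: \<alpha>_def recip_nonneg)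
  have r: "0 < r" using p by (cases p) (auto simp: r_def log_loss_def)
  have e_pos: "e > 0 \<longleftrightarrow> real m > 1 / q - recip p" and e_0: "e = 0 \<longleftrightarrow> real m = 1 / q - recip p"
    using q by (auto simp: e_def \<alpha>_def field_simps)
  have qr: "q \<le> r" if "e = 0"
    using critical_exponent_order[OF p q m(1)] that e_0 by (simp add: r_def)
  have \<sigma>: "0 \<le> \<sigma>" if "e = 0" using qr[OF that] r by (simp add: \<sigma>_def)
  obtain C1 where C1: "C1 > 0" and sumC1: "\<And>L A D. 1 \<le> L \<Longrightarrow> 0 \<le> D \<Longrightarrow> (\<forall>i<L. 0 \<le> A i) \<Longrightarrow>
       (\<Sum>i<L. A i powr r) \<le> D powr r \<Longrightarrow>
       (\<Sum>i<L. (4 ^ i) powr e * A i powr q) \<le> C1 * weight_rate e \<sigma> L * D powr q"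
    using weighted_sum_le_rate[OF q(1) r qr] unfolding \<sigma>_def by blast
  obtain C2 where C2: "C2 > 0" and rate: "\<And>L n. 1 \<le> L \<Longrightarrow> 2 ^ L \<le> n \<Longrightarrow> weight_rate e \<sigma> L \<le> C2 * R n"
      "\<And>L n. 1 \<le> L \<Longrightarrow> 2 ^ L \<le> n \<Longrightarrow> real n powr (2 * e) \<le> C2 * R n"
    using weight_rate_le[of e \<sigma>] \<sigma> unfolding R_def by blast
  \<comment> \<open>\<open>K1\<close> collects the constants of the shells, \<open>K2\<close> those of the interval next to \<open>1\<close>.\<close>
  define K1 where "K1 = (3/2) powr (1 - q) * (fact l * 4 ^ l) powr q * (C1 * C2 * (2 * (16/3) powr \<alpha>) powr q)"
  define K2 where "K2 = 8 * C2 * (8 ^ m * 2 * 16 powr \<alpha>) powr q"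
  have K: "0 < K1" "0 < K2" using C1 C2 by (auto simp: K1_def K2_def)
  have main: "Lq_norm (ereal q) (poly ((pderiv ^^ m) P)) \<le> (K1 + K2) powr (1/q) * markov_rate (ereal q) p m n * Lq_norm p (poly P)"
    if n: "2 \<le> n" and amp: "abs_mono_poly P k n" for n P
  proof -
    interpret abs_mono_poly P k n by fact
    let ?f = "poly ((pderiv ^^ m) P)"
    define N where "N = Lq_norm p (poly P)"
    have N0: "0 \<le> N" unfolding N_def by (intro Lq_norm_nonneg p continuous_intros)
    obtain L where L: "2 ^ L \<le> n" "n < 2 ^ (L + 1)" using ex_power_ivl1[of 2 n] n by auto
    \<comment> \<open>For \<open>L = 0\<close> the critical rate could be \<open>0\<close>, which does not cover the interval next to \<open>1\<close>.\<close>
    have "L \<noteq> 0" using L n by (cases "L = 0") auto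
    hence L1: "1 \<le> L" by simp
    have cont: "continuous_on {-1..1} (\<lambda>x. \<bar>?f x\<bar> powr q)"
      using q by (intro continuous_on_powr' continuous_intros) auto
    let ?b = "1 - 2/4^L :: real"
    have b: "-1 \<le> ?b" "?b \<le> 1" by (auto simp: divide_simps)
    have split: "integral {-1..?b} (\<lambda>x. \<bar>?f x\<bar> powr q) + integral {?b..1} (\<lambda>x. \<bar>?f x\<bar> powr q)
        = integral {-1..1} (\<lambda>x. \<bar>?f x\<bar> powr q)"
      using b cont by (intro Henstock_Kurzweil_Integration.integral_combine integrable_continuous_real) auto
    obtain A where A: "\<And>i. 0 \<le> A i" "\<And>i. integral {1 - 2/4^i .. 1 - 2/4^Suc i} ?f
        \<le> (fact l * 4 ^ l) * (4^i) ^ l * (4^i) powr \<alpha> * A i"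
      "\<And>L. (\<Sum>i<L. A i powr r) \<le> (2 * (16/3) powr \<alpha> * N) powr r"
      using shell_coefficients[of l p] m p unfolding l N_def r_def \<alpha>_def by blast
    have "integral {-1..?b} (\<lambda>x. \<bar>?f x\<bar> powr q)
        = (\<Sum>i<L. integral {1 - 2/4^i .. 1 - 2/4^Suc i} (\<lambda>x. \<bar>?f x\<bar> powr q))"
      using integral_shells[OF cont, of 2 L] by simp
    also have "\<dots> \<le> (\<Sum>i<L. (3/2) powr (1 - q) * (fact l * 4 ^ l) powr q * ((4 ^ i) powr e * A i powr q))"
      using shell_integral_le[of l q "fact l * 4 ^ l"] A(1,2) q m unfolding l e_def by (intro sum_mono) auto
    also have "\<dots> = (3/2) powr (1 - q) * (fact l * 4 ^ l) powr q * (\<Sum>i<L. (4 ^ i) powr e * A i powr q)"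
      by (simp only: sum_distrib_left)
    also have "(\<Sum>i<L. (4 ^ i) powr e * A i powr q) \<le> C1 * weight_rate e \<sigma> L * (2 * (16/3) powr \<alpha> * N) powr q"
      using A N0 by (intro sumC1 L1) auto
    also have "\<dots> \<le> C1 * (C2 * R n) * (2 * (16/3) powr \<alpha> * N) powr q"
      using rate(1)[OF L1 L(1)] C1 by (intro mult_right_mono mult_left_mono) auto
    also have "\<dots> = C1 * C2 * (2 * (16/3) powr \<alpha>) powr q * (R n * N powr q)"
      using N0 by (simp add: powr_mult mult_ac)
    finally have I1: "integral {-1..?b} (\<lambda>x. \<bar>?f x\<bar> powr q) \<le> K1 * (R n * N powr q)"
      by (simp add: K1_def mult_ac mult_left_mono)
    have n0: "0 < real n" using n by simp
    have sup: "\<bar>?f x\<bar> \<le> (8 ^ m * 2 * 16 powr \<alpha>) * (real n powr (2 * (real m + \<alpha>)) * N)" if "x \<in> {-1..1}" for x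
    proof -
      have "\<bar>?f x\<bar> \<le> (8 * (real n)\<^sup>2) ^ m * (2 * (16 * (real n)\<^sup>2) powr \<alpha> * N)"
        using value_at_one_le_norm[OF p] unfolding \<alpha>_def N_def
        by (intro order_trans[OF higher_deriv_le[OF that]] mult_left_mono) auto
      also have "(8 * (real n)\<^sup>2) ^ m = 8 ^ m * real n powr (2 * real m)"
        using powr_realpow[OF n0, of "2 * m"] by (simp add: power_mult_distrib power_mult)
      also have "(16 * (real n)\<^sup>2) powr \<alpha> = 16 powr \<alpha> * real n powr (2 * \<alpha>)"
        using n0 by (simp add: powr_mult square_powr)
      also have "8 ^ m * real n powr (2 * real m) * (2 * (16 powr \<alpha> * real n powr (2 * \<alpha>)) * N)
        = (8 ^ m * 2 * 16 powr \<alpha>) * ((real n powr (2 * real m) * real n powr (2 * \<alpha>)) * N)" by simp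
      also have "real n powr (2 * real m) * real n powr (2 * \<alpha>) = real n powr (2 * (real m + \<alpha>))"
        by (simp add: distrib_left flip: powr_add)
      finally show ?thesis .
    qed
    have "integral {?b..1} (\<lambda>x. \<bar>?f x\<bar> powr q)
        \<le> ((8 ^ m * 2 * 16 powr \<alpha>) * (real n powr (2 * (real m + \<alpha>)) * N)) powr q * (1 - ?b)"
      using sup b q by (intro integral_le_const integrable_powr continuous_intros powr_mono2) auto
    also have "\<dots> \<le> ((8 ^ m * 2 * 16 powr \<alpha>) * (real n powr (2 * (real m + \<alpha>)) * N)) powr q * (8 / (real n)\<^sup>2)"
    proof (rule mult_left_mono)
      have "real n < real (2 ^ (L + 1))" using L(2) by (simp only: of_nat_less_iff)
      hence "real n \<le> 2 * 2 ^ L" by simp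
      hence "(real n)\<^sup>2 \<le> (2 * 2 ^ L)\<^sup>2" by (intro power_mono) auto
      also have "\<dots> = 4 * 4 ^ L" by (simp add: power2_eq_square flip: power_mult_distrib)
      finally show "1 - ?b \<le> 8 / (real n)\<^sup>2" using n0 by (simp add: divide_simps)
    qed simp
    also have "\<dots> = 8 * (8 ^ m * 2 * 16 powr \<alpha>) powr q * (real n powr (2 * e) * N powr q)"
    proof -
      have "2 * e = 2 * (real m + \<alpha>) * q - 2" by (simp add: e_def algebra_simps)
      hence "real n powr (2 * e) = (real n powr (2 * (real m + \<alpha>))) powr q / (real n)\<^sup>2"
        using n0 by (simp only: powr_diff powr_powr) simp
      thus ?thesis using N0 by (simp add: powr_mult)
    qed
    also have "\<dots> \<le> 8 * (8 ^ m * 2 * 16 powr \<alpha>) powr q * ((C2 * R n) * N powr q)"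
      using rate(2)[OF L1 L(1)] by (intro mult_left_mono mult_right_mono) auto
    finally have I2: "integral {?b..1} (\<lambda>x. \<bar>?f x\<bar> powr q) \<le> K2 * (R n * N powr q)"
      by (simp add: K2_def mult_ac)
    have "integral {-1..1} (\<lambda>x. \<bar>?f x\<bar> powr q) \<le> (K1 + K2) * (R n * N powr q)"
      using I1 I2 split by (simp add: algebra_simps)
    hence "Lq_norm (ereal q) ?f \<le> ((K1 + K2) * (R n * N powr q)) powr (1/q)"
      using q by (subst Lq_norm_real) (auto intro!: powr_mono2 integral_nonneg integrable_powr continuous_intros)
    also have "\<dots> = (K1 + K2) powr (1/q) * (R n powr (1/q) * N)"
      using K N0 q by (simp add: powr_mult powr_powr R_def)
    also have "R n powr (1/q) = markov_rate (ereal q) p m n"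
    proof -
      have "2 * e / q = 2 * real m + 2 * recip p - 2 / q"
        using q by (simp add: e_def \<alpha>_def diff_divide_distrib distrib_left add_divide_distrib)
      moreover have "\<sigma> / q = 1 / q - log_loss p"
        using q r by (simp add: \<sigma>_def r_def diff_divide_distrib)
      moreover consider "e > 0" | "e = 0" | "e < 0" by linarith
      hence "R n powr (1/q) = (if e > 0 then real n powr (2 * e / q)
          else if e = 0 then ln (real n) powr (\<sigma> / q) else 1)"
        by cases (simp_all add: R_def powr_powr)
      ultimately show ?thesis by (simp only: markov_rate_def recip_simps e_0 e_pos) simp
    qed
    finally show ?thesis by (simp add: N_def mult_ac)
  qed
  have "0 < (K1 + K2) powr (1/q)" using K by simp
  thus ?thesis by (intro exI[of _ "(K1 + K2) powr (1/q)"] conjI allI impI main)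
qed

text \<open>For \<open>q \<ge> 1\<close> the order of magnitude is always the power of \<open>n\<close>: as \<open>m \<ge> 1 \<ge> \<beta>\<close>, the critical case occurs
  only for \<open>m = q = 1\<close> and \<open>p = \<infinity>\<close>, where both exponents vanish.\<close>

lemma norm_deriv_le_rate:
  assumes p: "0 < p" and q: "0 < q" and m: "1 \<le> m" "m \<le> k"
  shows "\<exists>C>0. \<forall>n P. 2 \<le> n \<longrightarrow> abs_mono_poly P k n \<longrightarrow>
    Lq_norm q (poly ((pderiv ^^ m) P)) \<le> C * markov_rate q p m n * Lq_norm p (poly P)"
proof (cases "1 \<le> q")
  case False
  then obtain r where "q = ereal r" "0 < r" "r \<le> 1" using q by (cases q) auto
  thus ?thesis using norm_deriv_le_of_lt_one[OF p _ _ m] by blast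
next
  case True
  define C where "C = 8 powr (real m - recip q) * (2 * 16 powr recip p)"
  have rq: "recip q \<le> 1" using True by (cases q) auto
  have rp: "0 \<le> recip p" by (rule recip_nonneg[OF p])
  have main: "Lq_norm q (poly ((pderiv ^^ m) P)) \<le> C * markov_rate q p m n * Lq_norm p (poly P)"
    if n: "2 \<le> n" and amp: "abs_mono_poly P k n" for n P
  proof -
    interpret abs_mono_poly P k n by fact
    have n0: "0 < real n" using n by simp
    have rate: "markov_rate q p m n = real n powr (2 * real m + 2 * recip p - 2 * recip q)"
    proof (cases "real m > recip q - recip p")
      case False
      hence eq: "real m = 1" "recip q = 1" "recip p = 0" using m rq rp by auto
      have "p = \<infinity>" using eq(3) p by (cases p) auto
      thus ?thesis using eq n by (simp add: markov_rate_def log_loss_def)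
    qed (simp add: markov_rate_def)
    have sq: "(c * (real n)\<^sup>2) powr a = c powr a * real n powr (2 * a)" if "0 \<le> c" for a c
      using n0 that by (simp add: powr_mult square_powr)
    have "Lq_norm q (poly ((pderiv ^^ m) P)) \<le> (8 * (real n)\<^sup>2) powr (real m - recip q) *
        (2 * (16 * (real n)\<^sup>2) powr recip p * Lq_norm p (poly P))"
      by (rule norm_deriv_le_of_ge_one[OF p True m])
    also have "\<dots> = C * (real n powr (2 * (real m - recip q)) * real n powr (2 * recip p)) * Lq_norm p (poly P)"
      by (simp add: sq C_def)
    also have "real n powr (2 * (real m - recip q)) * real n powr (2 * recip p) = markov_rate q p m n"
      unfolding rate by (simp add: algebra_simps flip: powr_add)
    finally show ?thesis .
  qed
  have "0 < C" by (simp add: C_def)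
  thus ?thesis by (intro exI[of _ C] conjI allI impI main)
qed

section \<open>Extremal polynomials\<close>

text \<open>The polynomial \<open>(1 - T\<^sub>n(x)) / (1 - x)\<close> for the Chebyshev polynomial \<open>T\<^sub>n\<close>, that is, \<open>n\<close> times the Fejer
  kernel in the variable \<open>x = cos \<theta>\<close>. The recursion is that of the Chebyshev polynomials after the
  division.\<close>

fun fejer :: "nat \<Rightarrow> real poly" where
  "fejer 0 = 0"
| "fejer (Suc 0) = 1"
| "fejer (Suc (Suc n)) = [:0, 2:] * fejer (Suc n) - fejer n + [:2:]"

lemma fejer_cos: "(1 - cos \<theta>) * poly (fejer n) (cos \<theta>) = 1 - cos (real n * \<theta>)"
proof (induction n rule: fejer.induct)
  case (3 n)
  have "cos (real (Suc (Suc n)) * \<theta>) + cos (real n * \<theta>) = 2 * cos \<theta> * cos (real (Suc n) * \<theta>)"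
  proof -
    have "real (Suc (Suc n)) * \<theta> = real (Suc n) * \<theta> + \<theta>" "real n * \<theta> = real (Suc n) * \<theta> - \<theta>"
      by (simp_all add: algebra_simps)
    thus ?thesis by (simp only: cos_add cos_diff) simp
  qed
  hence c: "cos (real (Suc (Suc n)) * \<theta>) = 2 * cos \<theta> * cos (real (Suc n) * \<theta>) - cos (real n * \<theta>)"
    by linarith
  have "(1 - cos \<theta>) * poly (fejer (Suc (Suc n))) (cos \<theta>)
      = 2 * cos \<theta> * ((1 - cos \<theta>) * poly (fejer (Suc n)) (cos \<theta>))
        - (1 - cos \<theta>) * poly (fejer n) (cos \<theta>) + 2 * (1 - cos \<theta>)"
    by (simp add: algebra_simps)
  also have "\<dots> = 2 * cos \<theta> * (1 - cos (real (Suc n) * \<theta>)) - (1 - cos (real n * \<theta>)) + 2 * (1 - cos \<theta>)"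
    unfolding 3 ..
  also have "\<dots> = 1 - cos (real (Suc (Suc n)) * \<theta>)"
    unfolding c by (simp add: algebra_simps)
  finally show ?case .
qed simp_all

lemma fejer_one: "poly (fejer n) 1 = (real n)\<^sup>2"
  by (induction n rule: fejer.induct) (auto simp: power2_eq_square algebra_simps)

lemma degree_fejer: "degree (fejer n) \<le> n - 1"
proof (induction n rule: fejer.induct)
  case (3 n)
  have "degree ([:0, 2:] * fejer (Suc n)) \<le> degree [:0, 2::real:] + degree (fejer (Suc n))"
    by (rule degree_mult_le)
  also have "\<dots> \<le> Suc n" using 3 by simp
  finally show ?case using 3 by (auto intro!: degree_add_le degree_diff_le)
qed auto

lemma abs_sin_mult_le: "\<bar>sin (real n * t)\<bar> \<le> real n * \<bar>sin t\<bar>"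
proof (induction n)
  case (Suc n)
  have "\<bar>sin (real (Suc n) * t)\<bar> = \<bar>sin (real n * t) * cos t + cos (real n * t) * sin t\<bar>"
  proof -
    have "real (Suc n) * t = real n * t + t" by (simp add: algebra_simps)
    thus ?thesis by (simp only: sin_add)
  qed
  also have "\<dots> \<le> \<bar>sin (real n * t)\<bar> * \<bar>cos t\<bar> + \<bar>cos (real n * t)\<bar> * \<bar>sin t\<bar>"
    by (metis abs_mult abs_triangle_ineq)
  also have "\<dots> \<le> \<bar>sin (real n * t)\<bar> * 1 + 1 * \<bar>sin t\<bar>"
    by (intro add_mono mult_mono) auto
  finally show ?case using Suc by (simp add: algebra_simps)
qed simp

lemma fejer_bounds:
  assumes "x \<in> {-1..1}"
  shows "0 \<le> poly (fejer n) x" "poly (fejer n) x \<le> (real n)\<^sup>2" "(1 - x) * poly (fejer n) x \<le> 2"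
proof -
  define \<theta> where "\<theta> = arccos x"
  have x: "x = cos \<theta>" using assms by (simp add: \<theta>_def cos_arccos)
  have f: "(1 - x) * poly (fejer n) x = 1 - cos (real n * \<theta>)" unfolding x by (rule fejer_cos)
  show "(1 - x) * poly (fejer n) x \<le> 2" unfolding f using cos_ge_minus_one[of "real n * \<theta>"] by linarith
  have half: "1 - cos t = 2 * (sin (t / 2))\<^sup>2" for t :: real
    using cos_double_sin[of "t / 2"] by simp
  have "0 \<le> poly (fejer n) x \<and> poly (fejer n) x \<le> (real n)\<^sup>2"
  proof (cases "x = 1")
    case True
    thus ?thesis by (simp add: fejer_one)
  next
    case False
    hence x1: "0 < 1 - x" using assms by auto
    have "0 \<le> (1 - x) * poly (fejer n) x" unfolding f by simp
    hence "0 \<le> poly (fejer n) x" using x1 by (simp add: zero_le_mult_iff)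
    moreover have "(1 - x) * poly (fejer n) x \<le> (1 - x) * (real n)\<^sup>2"
    proof -
      have "\<bar>sin (real n * (\<theta> / 2))\<bar>\<^sup>2 \<le> (real n * \<bar>sin (\<theta> / 2)\<bar>)\<^sup>2"
        by (intro power_mono abs_sin_mult_le) simp
      hence "(sin (real n * \<theta> / 2))\<^sup>2 \<le> (real n)\<^sup>2 * (sin (\<theta> / 2))\<^sup>2"
        by (simp add: power_mult_distrib)
      thus ?thesis unfolding f unfolding x half by (simp add: mult.commute)
    qed
    ultimately show ?thesis using x1 by simp
  qed
  thus "0 \<le> poly (fejer n) x" "poly (fejer n) x \<le> (real n)\<^sup>2" by auto
qed

text \<open>The primitive that vanishes at \<open>-1\<close>. This normalisation keeps iterated primitives of a nonnegative
  polynomial nonnegative on \<open>[-1, 1]\<close>.\<close>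

definition primitive :: "real poly \<Rightarrow> real poly" where
  "primitive Q = (let R = (\<Sum>i\<le>degree Q. monom (coeff Q i / real (Suc i)) (Suc i)) in R - [:poly R (-1):])"

lemma pderiv_primitive [simp]: "pderiv (primitive Q) = Q"
proof -
  have "pderiv (primitive Q) = (\<Sum>i\<le>degree Q. pderiv (monom (coeff Q i / real (Suc i)) (Suc i)))"
    by (simp add: primitive_def Let_def pderiv_diff pderiv_pCons higher_pderiv_sum[of 1, simplified])
  also have "\<dots> = (\<Sum>i\<le>degree Q. monom (coeff Q i) i)"
    by (intro sum.cong) (auto simp: pderiv_monom simp del: of_nat_Suc)
  finally show ?thesis by (simp add: poly_as_sum_of_monoms)
qed

lemma primitive_minus_one [simp]: "poly (primitive Q) (-1) = 0"
  by (simp add: primitive_def Let_def)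

lemma degree_primitive: "degree (primitive Q) \<le> Suc (degree Q)"
  unfolding primitive_def Let_def
  by (intro degree_diff_le degree_sum_le) (auto intro: order_trans[OF degree_monom_le])

lemma degree_iterated_primitive: "degree ((primitive ^^ j) Q) \<le> j + degree Q"
  by (induction j) (auto intro: order_trans[OF degree_primitive])

lemma higher_pderiv_primitive:
  "j \<le> k \<Longrightarrow> (pderiv ^^ j) ((primitive ^^ k) Q) = (primitive ^^ (k - j)) Q"
proof (induction j)
  case (Suc j)
  hence "(pderiv ^^ Suc j) ((primitive ^^ k) Q) = pderiv ((primitive ^^ (Suc (k - Suc j))) Q)"
    by (simp add: Suc_diff_Suc del: funpow.simps(2)) simp
  thus ?case by simp
qed simp

lemma poly_le_primitive:
  assumes g: "\<And>x. x \<in> {x0..1} \<Longrightarrow> (g has_real_derivative g' x) (at x)"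
    and le: "\<And>x. x \<in> {x0..1} \<Longrightarrow> g' x \<le> poly Q x"
    and x0: "g x0 \<le> poly (primitive Q) x0" and x: "x \<in> {x0..1}"
  shows "g x \<le> poly (primitive Q) x"
proof -
  have "poly (primitive Q) x0 - g x0 \<le> poly (primitive Q) x - g x"
  proof (rule DERIV_nonneg_imp_nondecreasing[of x0 x])
    fix u assume u: "x0 \<le> u" "u \<le> x"
    have "((\<lambda>x. poly (primitive Q) x - g x) has_real_derivative poly Q u - g' u) (at u)"
      using u x poly_DERIV[of "primitive Q" u] by (intro DERIV_diff g) auto
    thus "\<exists>d. ((\<lambda>x. poly (primitive Q) x - g x) has_real_derivative d) (at u) \<and> 0 \<le> d"
      using le[of u] u x by (intro exI[of _ "poly Q u - g' u"]) auto
  qed (use x in auto)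
  thus ?thesis using x0 by simp
qed

lemma primitive_le:
  assumes g: "\<And>x. x \<in> {-1..1} \<Longrightarrow> (g has_real_derivative g' x) (at x)"
    and le: "\<And>x. x \<in> {-1..1} \<Longrightarrow> poly Q x \<le> g' x"
    and x0: "0 \<le> g (-1)" and x: "x \<in> {-1..1}"
  shows "poly (primitive Q) x \<le> g x"
proof -
  have "g (-1) - poly (primitive Q) (-1) \<le> g x - poly (primitive Q) x"
  proof (rule DERIV_nonneg_imp_nondecreasing[of "-1" x])
    fix u assume u: "-1 \<le> u" "u \<le> x"
    have "((\<lambda>x. g x - poly (primitive Q) x) has_real_derivative g' u - poly Q u) (at u)"
      using u x poly_DERIV[of "primitive Q" u] by (intro DERIV_diff g) auto
    thus "\<exists>d. ((\<lambda>x. g x - poly (primitive Q) x) has_real_derivative d) (at u) \<and> 0 \<le> d"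
      using le[of u] u x by (intro exI[of _ "g' u - poly Q u"]) auto
  qed (use x in auto)
  thus ?thesis using x0 by simp
qed

lemma iterated_primitive_nonneg:
  assumes "\<And>x. x \<in> {-1..1} \<Longrightarrow> 0 \<le> poly Q x" "x \<in> {-1..1}"
  shows "0 \<le> poly ((primitive ^^ j) Q) x"
  using assms(2)
proof (induction j arbitrary: x)
  case (Suc j)
  have "(\<lambda>_. 0) x \<le> poly (primitive ((primitive ^^ j) Q)) x"
    by (rule poly_le_primitive[of "-1" "\<lambda>_. 0" "\<lambda>_. 0"]) (use Suc in auto)
  thus ?case by simp
qed (use assms in auto)

lemma iterated_primitive_ge:
  assumes nn: "\<And>x. x \<in> {-1..1} \<Longrightarrow> 0 \<le> poly Q x" and x0: "-1 \<le> x0"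
    and c: "\<And>x. x \<in> {x0..1} \<Longrightarrow> c \<le> poly Q x" and x: "x \<in> {x0..1}"
  shows "c * (x - x0) ^ j / fact j \<le> poly ((primitive ^^ j) Q) x"
  using x
proof (induction j arbitrary: x)
  case (Suc j)
  have f: "fact (Suc j) = real (Suc j) * fact j" by simp
  have "(\<lambda>x. c * (x - x0) ^ Suc j / fact (Suc j)) x \<le> poly (primitive ((primitive ^^ j) Q)) x"
  proof (rule poly_le_primitive[of x0 _ "\<lambda>x. c * (x - x0) ^ j / fact j"])
    fix x
    have "((\<lambda>x. c * (x - x0) ^ Suc j / fact (Suc j)) has_real_derivative
        c * (real (Suc j) * (x - x0) ^ j) / fact (Suc j)) (at x)"
      by (rule derivative_eq_intros refl | simp)+
    thus "((\<lambda>x. c * (x - x0) ^ Suc j / fact (Suc j)) has_real_derivative c * (x - x0) ^ j / fact j) (at x)"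
      unfolding f by (simp add: divide_simps)
    show "c * (x0 - x0) ^ Suc j / fact (Suc j) \<le> poly (primitive ((primitive ^^ j) Q)) x0"
      using iterated_primitive_nonneg[OF nn, of x0 "Suc j"] x0 Suc.prems by simp
  qed (use Suc in auto)
  thus ?case by simp
qed (use c in auto)

text \<open>A primitive of \<open>(1 + W(1 - x))\<^bsup>-a-1\<^esup>\<close> is \<open>(1 + W(1 - x))\<^bsup>-a\<^esup> / (W a)\<close>. So each integration costs one power of
  the decay and gains a factor \<open>1/W\<close>.\<close>

lemma iterated_primitive_le:
  assumes W: "0 < W" and a: "1 \<le> a" and C: "0 \<le> C"
    and le: "\<And>x. x \<in> {-1..1} \<Longrightarrow> poly Q x \<le> C / (1 + W * (1 - x)) ^ (j + a)" and x: "x \<in> {-1..1}"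
  shows "poly ((primitive ^^ j) Q) x \<le> C / W ^ j / (1 + W * (1 - x)) ^ a"
  using a le x
proof (induction j arbitrary: a x)
  case (Suc j)
  define b where "b = (\<lambda>x. 1 + W * (1 - x))"
  have b: "1 \<le> b x" if "x \<in> {-1..1}" for x using W that by (simp add: b_def)
  have IH: "poly ((primitive ^^ j) Q) x \<le> C / W ^ j / b x ^ Suc a" if "x \<in> {-1..1}" for x
    unfolding b_def by (rule Suc.IH) (use Suc.prems that in auto)
  have "poly (primitive ((primitive ^^ j) Q)) x \<le> (\<lambda>x. C / W ^ Suc j / b x ^ a) x"
  proof (rule primitive_le[of _ "\<lambda>x. real a * (C / W ^ j / b x ^ Suc a)"])
    fix x :: real assume x: "x \<in> {-1..1}"
    have nz: "b x \<noteq> 0" using b[OF x] by auto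
    have db: "(b has_real_derivative - W) (at x)"
      unfolding b_def by (auto intro!: derivative_eq_intros)
    obtain a' where a': "a = Suc a'" using Suc.prems(1) by (cases a) auto
    have "((\<lambda>x. C / W ^ Suc j / b x ^ a) has_real_derivative
        (0 * b x ^ a - C / W ^ Suc j * (real a * b x ^ a' * (- W))) / (b x ^ a * b x ^ a)) (at x)"
    proof (rule DERIV_divide[OF DERIV_const])
      show "((\<lambda>x. b x ^ a) has_real_derivative real a * b x ^ a' * (- W)) (at x)"
        using DERIV_power_Suc[OF db, of a'] by (simp add: a' mult_ac)
    qed (use nz in auto)
    also have "(0 * b x ^ a - C / W ^ Suc j * (real a * b x ^ a' * (- W))) / (b x ^ a * b x ^ a)
        = real a * (C / W ^ j / b x ^ Suc a)"
      using nz W a' by (simp add: divide_simps)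
    finally show "((\<lambda>x. C / W ^ Suc j / b x ^ a) has_real_derivative real a * (C / W ^ j / b x ^ Suc a)) (at x)" .
    have "0 \<le> C / W ^ j / b x ^ Suc a" using C W b[OF x] by simp
    hence "1 * (C / W ^ j / b x ^ Suc a) \<le> real a * (C / W ^ j / b x ^ Suc a)"
      using Suc.prems(1) by (intro mult_right_mono) auto
    thus "poly ((primitive ^^ j) Q) x \<le> real a * (C / W ^ j / b x ^ Suc a)"
      using IH[OF x] by linarith
  next
    show "0 \<le> C / W ^ Suc j / b (-1) ^ a" using C W b[of "-1"] by simp
  qed (use Suc.prems in auto)
  thus ?case by (simp add: b_def)
qed auto

text \<open>The \<open>k\<close>-th derivative is a power of the Fejer kernel, normalised to have maximum \<open>1\<close>. The power \<open>k + a\<close>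
  leaves decay of order \<open>a\<close> after the \<open>k\<close> integrations.\<close>

definition bump :: "nat \<Rightarrow> nat \<Rightarrow> nat \<Rightarrow> real poly" where
  "bump k a M = (primitive ^^ k) (smult (1 / (real M)\<^sup>2) (fejer M) ^ (k + a))"

lemma degree_bump: "degree (bump k a M) \<le> k + (k + a) * (M - 1)"
proof -
  have "degree (smult (1 / (real M)\<^sup>2) (fejer M) ^ (k + a)) \<le> (k + a) * (M - 1)"
    using degree_fejer[of M] by (auto intro!: order_trans[OF degree_power_le] simp: mult.commute)
  thus ?thesis unfolding bump_def by (intro order_trans[OF degree_iterated_primitive]) auto
qed

context
  fixes k a M :: nat
  assumes M: "1 \<le> M" and a: "1 \<le> a"
begin

private lemma kernel_nonneg: "x \<in> {-1..1} \<Longrightarrow> 0 \<le> poly (smult (1 / (real M)\<^sup>2) (fejer M) ^ (k + a)) x"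
  using fejer_bounds(1)[of x M] by (simp add: poly_power)

lemma bump_nonneg:
  assumes "j \<le> k" "x \<in> {-1..1}"
  shows "0 \<le> poly ((pderiv ^^ j) (bump k a M)) x"
  unfolding bump_def higher_pderiv_primitive[OF assms(1)]
  by (rule iterated_primitive_nonneg[OF kernel_nonneg assms(2)])

text \<open>The normalised kernel is at most \<open>1\<close> and at most \<open>2/y\<close> with \<open>y = M\<^sup>2 (1 - x)\<close>, hence at most
  \<open>3 / (1 + y)\<close>.\<close>

lemma bump_le:
  assumes x: "x \<in> {-1..1}"
  shows "poly (bump k a M) x \<le> 3 ^ (k + a) / ((real M)\<^sup>2) ^ k / (1 + (real M)\<^sup>2 * (1 - x)) ^ a"
  unfolding bump_def
proof (rule iterated_primitive_le[OF _ a _ _ x])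
  fix x :: real assume x: "x \<in> {-1..1}"
  \<comment> \<open>In the variable \<open>y\<close> the kernel \<open>f\<close> satisfies \<open>f \<le> 1\<close> and \<open>y f \<le> 2\<close>.\<close>
  define y where "y = (real M)\<^sup>2 * (1 - x)"
  have M2: "0 < (real M)\<^sup>2" using M by simp
  have y: "0 \<le> y" using x by (simp add: y_def)
  define f where "f = poly (fejer M) x / (real M)\<^sup>2"
  have f: "0 \<le> f" "f \<le> 1" using fejer_bounds[OF x, of M] M2 by (auto simp: f_def)
  have "y * f \<le> 2" using fejer_bounds(3)[OF x, of M] M2 by (simp add: y_def f_def)
  hence "f * (1 + y) \<le> 3" using f by (simp add: algebra_simps)
  hence "f \<le> 3 / (1 + y)" using y by (simp add: pos_le_divide_eq)
  hence "f ^ (k + a) \<le> (3 / (1 + y)) ^ (k + a)" using f by (intro power_mono) auto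
  thus "poly (smult (1 / (real M)\<^sup>2) (fejer M) ^ (k + a)) x \<le> 3 ^ (k + a) / (1 + (real M)\<^sup>2 * (1 - x)) ^ (k + a)"
    by (simp add: poly_power f_def y_def power_divide)
qed (use M in auto)

text \<open>The kernel attains its maximum at \<open>1\<close>, so it is at least half of it up to distance \<open>2h\<close> with
  \<open>h = 1 / (32 M\<^sup>2)\<close>. Integrating that over an interval of length at least \<open>h\<close> gives the factor
  \<open>h\<^bsup>k-j\<^esup>\<close>.\<close>

lemma bump_ge:
  assumes j: "j \<le> k" and x: "x \<in> {1 - 1 / (32 * (real M)\<^sup>2)..1}"
  shows "(1 / 2) ^ (k + a) / (32 ^ k * fact k) / ((real M)\<^sup>2) ^ (k - j) \<le> poly ((pderiv ^^ j) (bump k a M)) x"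
proof -
  have M2: "1 \<le> (real M)\<^sup>2" using M by simp
  define h where "h = 1 / (32 * (real M)\<^sup>2)"
  have "1 \<le> 16 * (real M)\<^sup>2" using M2 by linarith
  hence h: "0 < h" "2 * h \<le> 1" using M by (auto simp: h_def divide_le_eq)
  have x0: "x \<in> {1 - 2 * h..1}" "h \<le> x - (1 - 2 * h)" using x h by (auto simp: h_def)
  have ker: "(1 / 2) ^ (k + a) \<le> poly (smult (1 / (real M)\<^sup>2) (fejer M) ^ (k + a)) x" if "x \<in> {1 - 2 * h..1}" for x
  proof -
    have "(real M)\<^sup>2 / 2 \<le> poly (fejer M) x"
      by (rule poly_ge_half_near_one[of "fejer M" M])
         (use degree_fejer[of M] M that fejer_bounds fejer_one in \<open>auto simp: h_def\<close>)
    hence "1 / 2 \<le> poly (fejer M) x / (real M)\<^sup>2" using M by (simp add: field_simps)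
    hence "(1 / 2) ^ (k + a) \<le> (poly (fejer M) x / (real M)\<^sup>2) ^ (k + a)" by (intro power_mono) auto
    thus ?thesis by (simp add: poly_power)
  qed
  let ?i = "k - j"
  have "(1 / 2) ^ (k + a) * h ^ ?i / fact ?i \<le> (1 / 2) ^ (k + a) * (x - (1 - 2 * h)) ^ ?i / fact ?i"
    using x0 h by (intro divide_right_mono mult_left_mono power_mono) auto
  also have "\<dots> \<le> poly ((pderiv ^^ j) (bump k a M)) x"
    unfolding bump_def higher_pderiv_primitive[OF j]
    by (rule iterated_primitive_ge[OF kernel_nonneg _ ker]) (use x0 h in auto)
  finally have 1: "(1 / 2) ^ (k + a) * h ^ ?i / fact ?i \<le> poly ((pderiv ^^ j) (bump k a M)) x" .
  have "(1 / 2) ^ (k + a) / (32 ^ k * fact k) / ((real M)\<^sup>2) ^ ?i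
      \<le> (1 / 2) ^ (k + a) / (32 ^ ?i * fact ?i) / ((real M)\<^sup>2) ^ ?i"
    using M2 by (intro divide_right_mono divide_left_mono mult_mono power_increasing fact_mono) auto
  also have "\<dots> = (1 / 2) ^ (k + a) * h ^ ?i / fact ?i"
    by (simp add: h_def power_mult_distrib power_divide)
  finally show ?thesis using 1 by linarith
qed

end

section \<open>Lower bounds\<close>

lemma markov_rate_nonneg: "0 \<le> markov_rate q p m n"
  by (simp add: markov_rate_def)

lemma abs_mono_polys_iff:
  assumes "1 \<le> n" "1 \<le> k"
  shows "P \<in> abs_mono_polys k n \<longleftrightarrow> abs_mono_poly P k n"
  using assms by (auto simp: abs_mono_polys_def absolutely_monotone_poly_iff abs_mono_poly_def)

text \<open>A ratio with norm zero in the denominator would be \<open>0\<close>. The upper bound excludes this, because it would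
  force the numerator to vanish as well.\<close>

lemma markov_const_ge:
  assumes amp: "abs_mono_poly P k n" and n: "2 \<le> n" and p: "0 < p" and q: "0 < q" and m: "1 \<le> m" "m \<le> k"
    and u: "0 < u" "u \<le> Lq_norm q (poly ((pderiv ^^ m) P))"
    and v: "Lq_norm p (poly P) \<le> v"
  shows "ereal (u / v) \<le> markov_const k q p n m"
proof -
  let ?N = "Lq_norm p (poly P)"
  have N0: "0 \<le> ?N" by (intro Lq_norm_nonneg p continuous_intros)
  have "?N \<noteq> 0"
  proof
    assume "?N = 0"
    moreover obtain C where "Lq_norm q (poly ((pderiv ^^ m) P)) \<le> C * markov_rate q p m n * ?N"
      using norm_deriv_le_rate[OF p q m] n amp by blast
    ultimately show False using u by simp
  qed
  hence N: "0 < ?N" using N0 by simp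
  have "P \<noteq> 0"
  proof
    assume "P = 0"
    hence "?N = 0" by (simp add: Lq_norm_def)
    thus False using N by simp
  qed
  moreover have "P \<in> abs_mono_polys k n"
    using amp abs_mono_polys_iff[of n k P] n m by simp
  ultimately have "ereal (Lq_norm q (poly ((pderiv ^^ m) P)) / ?N) \<le> markov_const k q p n m"
    unfolding markov_const_def by (intro SUP_upper) auto
  moreover have "u / v \<le> Lq_norm q (poly ((pderiv ^^ m) P)) / ?N"
    using u v N by (intro frac_le) auto
  ultimately show ?thesis by (meson ereal_less_eq(3) order_trans)
qed

text \<open>The condition on \<open>a\<close> makes the \<open>p\<close>-th power of the bump decay at least quadratically in
  \<open>M\<^sup>2 (1 - x)\<close>, so that its integral is of order \<open>M\<^bsup>-2\<^esup>\<close>.\<close>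

lemma bump_norm_le:
  assumes M: "1 \<le> M" and a: "1 \<le> a" "2 * recip p \<le> real a" and p: "0 < p"
  shows "Lq_norm p (poly (bump k a M)) \<le> 3 ^ (k + a) / ((real M)\<^sup>2) ^ k / ((real M)\<^sup>2) powr recip p"
proof -
  define W where "W = (real M)\<^sup>2"
  define K where "K = 3 ^ (k + a) / W ^ k"
  have W: "0 < W" and K: "0 < K" using M by (auto simp: W_def K_def)
  define b where "b = (\<lambda>x. 1 + W * (1 - x))"
  have b: "1 \<le> b x" if "x \<in> {-1..1}" for x using W that by (simp add: b_def)
  have le: "\<bar>poly (bump k a M) x\<bar> \<le> K / b x ^ a" if "x \<in> {-1..1}" for x
    using bump_le[OF M a(1) that, of k] bump_nonneg[OF M a(1), of 0 k x] that by (simp add: K_def W_def b_def)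
  have "Lq_norm p (poly (bump k a M)) \<le> K / W powr recip p"
  proof (cases p)
    case PInf
    have "(SUP x\<in>{-1..1}. \<bar>poly (bump k a M) x\<bar>) \<le> K"
    proof (rule cSUP_least)
      fix x :: real assume x: "x \<in> {-1..1}"
      have "K / b x ^ a \<le> K / 1" using b[OF x] K by (intro divide_left_mono) auto
      thus "\<bar>poly (bump k a M) x\<bar> \<le> K" using le[OF x] by simp
    qed auto
    thus ?thesis using PInf W by (simp add: Lq_norm_def)
  next
    case (real r)
    hence r: "0 < r" "2 \<le> a * r" using p a by (auto simp: field_simps)
    have hi: "((\<lambda>x. K powr r / (b x)\<^sup>2) has_integral K powr r / (W * b 1) - K powr r / (W * b (-1))) {-1..1}"
    proof (rule fundamental_theorem_of_calculus)
      fix x :: real assume x: "x \<in> {-1..1}"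
      have nz: "b x \<noteq> 0" using b[OF x] by simp
      have "((\<lambda>x. K powr r / (W * b x)) has_real_derivative
          (0 * (W * b x) - K powr r * (W * (- W))) / ((W * b x) * (W * b x))) (at x)"
      proof (rule DERIV_divide[OF DERIV_const])
        show "((\<lambda>x. W * b x) has_real_derivative W * (- W)) (at x)"
          unfolding b_def by (auto intro!: derivative_eq_intros)
      qed (use nz W in auto)
      also have "(0 * (W * b x) - K powr r * (W * (- W))) / ((W * b x) * (W * b x)) = K powr r / (b x)\<^sup>2"
        using nz W by (simp add: divide_simps power2_eq_square)
      finally have "((\<lambda>x. K powr r / (W * b x)) has_real_derivative K powr r / (b x)\<^sup>2) (at x)" .
      thus "((\<lambda>x. K powr r / (W * b x)) has_vector_derivative K powr r / (b x)\<^sup>2) (at x within {-1..1})"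
        by (simp add: has_real_derivative_iff_has_vector_derivative[symmetric] has_field_derivative_at_within)
    qed simp
    have "integral {-1..1} (\<lambda>x. \<bar>poly (bump k a M) x\<bar> powr r) \<le> integral {-1..1} (\<lambda>x. K powr r / (b x)\<^sup>2)"
    proof (rule integral_le)
      show "(\<lambda>x. \<bar>poly (bump k a M) x\<bar> powr r) integrable_on {-1..1}"
        using r by (intro integrable_powr continuous_intros) auto
      show "(\<lambda>x. K powr r / (b x)\<^sup>2) integrable_on {-1..1}"
        using hi by (rule has_integral_integrable)
      fix x :: real assume x: "x \<in> {-1..1}"
      have bx: "1 \<le> b x" by (rule b[OF x])
      have "\<bar>poly (bump k a M) x\<bar> powr r \<le> (K / b x ^ a) powr r"
        using le[OF x] r by (intro powr_mono2) auto
      also have "\<dots> = K powr r / (b x) powr (a * r)"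
        using bx K by (simp add: powr_divide powr_powr flip: powr_realpow)
      also have "\<dots> \<le> K powr r / (b x) powr 2"
        using bx r by (intro divide_left_mono powr_mono) auto
      finally show "\<bar>poly (bump k a M) x\<bar> powr r \<le> K powr r / (b x)\<^sup>2"
        using bx by simp
    qed
    also have "\<dots> = K powr r / (W * b 1) - K powr r / (W * b (-1))" using hi by (rule integral_unique)
    also have "\<dots> \<le> K powr r / W" using W b[of "-1"] by (simp add: b_def)
    finally have "Lq_norm p (poly (bump k a M)) \<le> (K powr r / W) powr (1/r)"
      unfolding real using r
      by (subst Lq_norm_real) (auto intro!: powr_mono2 integral_nonneg integrable_powr continuous_on_poly continuous_on_id)
    thus ?thesis using real r K W by (simp add: powr_divide powr_powr)
  qed (use p in auto)
  thus ?thesis by (simp add: K_def W_def)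
qed

definition bump_height :: "nat \<Rightarrow> nat \<Rightarrow> real" where
  "bump_height k a = (1 / 2) ^ (k + a) / (32 ^ k * fact k)"

lemma bump_height_pos: "0 < bump_height k a"
  by (simp add: bump_height_def)

lemma abs_mono_poly_bump:
  assumes "1 \<le> M" "1 \<le> a" "1 \<le> n" "1 \<le> k" "k + (k + a) * (M - 1) \<le> n"
  shows "abs_mono_poly (bump k a M) k n"
  using assms degree_bump[of k a M] bump_nonneg[OF assms(1,2)] by unfold_locales auto

lemma markov_const_ge_single_bump:
  assumes M: "1 \<le> M" "k + (k + a) * (M - 1) \<le> n" and a: "1 \<le> a" "2 * recip p \<le> real a"
    and n: "2 \<le> n" and p: "0 < p" and q: "0 < q" and m: "1 \<le> m" "m \<le> k"
  shows "ereal (bump_height k a * (1/32) powr recip q / 3 ^ (k + a) * ((real M)\<^sup>2) powr (real m + recip p - recip q))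
    \<le> markov_const k q p n m"
proof -
  define W where "W = (real M)\<^sup>2"
  have W: "1 \<le> W" using M by (simp add: W_def)
  define u where "u = bump_height k a / W ^ (k - m) * (1 / (32 * W)) powr recip q"
  define v where "v = 3 ^ (k + a) / W ^ k / W powr recip p"
  have amp: "abs_mono_poly (bump k a M) k n" using M a n m by (intro abs_mono_poly_bump) auto
  have h: "0 < 1 / (32 * W)" "1 / (32 * W) \<le> 1" using W by (auto simp: divide_le_eq)
  have "ereal (u / v) \<le> markov_const k q p n m"
  proof (rule markov_const_ge[OF amp n p q m])
    show "0 < u" using W bump_height_pos[of k a] by (simp add: u_def)
    have "bump_height k a / W ^ (k - m) * (1 - (1 - 1 / (32 * W))) powr recip q
        \<le> Lq_norm q (poly ((pderiv ^^ m) (bump k a M)))"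
    proof (rule Lq_norm_ge[OF q])
      fix x assume x: "x \<in> {1 - 1 / (32 * W)..1}"
      have "bump_height k a / W ^ (k - m) \<le> poly ((pderiv ^^ m) (bump k a M)) x"
        using bump_ge[OF M(1) a(1) m(2), of x] x unfolding W_def bump_height_def by simp
      thus "bump_height k a / W ^ (k - m) \<le> \<bar>poly ((pderiv ^^ m) (bump k a M)) x\<bar>" by simp
    next
      show "0 \<le> bump_height k a / W ^ (k - m)" using W bump_height_pos[of k a] by simp
      show "- 1 \<le> 1 - 1 / (32 * W)" using h by linarith
    qed (use h in \<open>auto intro!: continuous_on_poly continuous_on_id\<close>)
    thus "u \<le> Lq_norm q (poly ((pderiv ^^ m) (bump k a M)))" by (simp add: u_def)
    show "Lq_norm p (poly (bump k a M)) \<le> v"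
      unfolding v_def W_def by (rule bump_norm_le[OF M(1) a p])
  qed
  moreover have "u / v = bump_height k a * (1/32) powr recip q / 3 ^ (k + a) * W powr (real m + recip p - recip q)"
  proof -
    have "W ^ k = W ^ (k - m) * W ^ m" using m by (simp flip: power_add)
    hence "u / v = bump_height k a * (1/32) powr recip q / 3 ^ (k + a) * (W ^ m * W powr recip p / W powr recip q)"
      using W unfolding u_def v_def by (simp add: powr_divide powr_mult divide_simps)
    also have "W ^ m * W powr recip p / W powr recip q = W powr (real m + recip p - recip q)"
      using W by (simp add: powr_add powr_diff powr_realpow)
    finally show ?thesis .
  qed
  ultimately show ?thesis by (simp add: W_def)
qed

text \<open>The largest scale that the degree \<open>n\<close> admits is proportional to \<open>n\<close>. For \<open>n < s\<close> the scale \<open>1\<close> still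
  fits, because the bump of scale \<open>1\<close> has degree only \<open>k\<close>.\<close>

lemma scale_exists:
  fixes k s n :: nat
  assumes "k \<le> s" "k \<le> n" "1 \<le> s"
  shows "\<exists>M\<ge>1. k + s * (M - 1) \<le> n \<and> n \<le> 2 * s * M"
proof (intro exI[of _ "max 1 (n div s)"] conjI)
  show "1 \<le> max 1 (n div s)" by simp
  show "k + s * (max 1 (n div s) - 1) \<le> n"
  proof (cases "n div s \<le> 1")
    case False
    hence "k + s * (n div s - 1) \<le> s * (n div s)" using assms by (cases "n div s") auto
    also have "\<dots> \<le> n" by simp
    finally show ?thesis using False by simp
  qed (use assms in simp)
  have "n < s + n div s * s" using assms by (intro dividend_less_div_times) auto
  also have "\<dots> \<le> s * max 1 (n div s) + max 1 (n div s) * s"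
    by (intro add_mono mult_right_mono) auto
  finally show "n \<le> 2 * s * max 1 (n div s)" by (simp add: mult_ac)
qed

text \<open>The weights make the \<open>m\<close>-th derivative of the \<open>i\<close>-th term of order \<open>4\<^bsup>i(m+\<alpha>)\<^esup>\<close> at distance
  about \<open>4\<^bsup>-i\<^esup>\<close> from \<open>1\<close>, and the term itself of order \<open>4\<^bsup>i\<alpha>\<^esup>\<close> there.\<close>

definition multiscale :: "nat \<Rightarrow> nat \<Rightarrow> real \<Rightarrow> nat \<Rightarrow> real poly" where
  "multiscale k a \<alpha> L = (\<Sum>i\<le>L. smult ((4 ^ i) powr (real k + \<alpha>)) (bump k a (2 ^ i)))"

lemma higher_deriv_multiscale:
  "poly ((pderiv ^^ j) (multiscale k a \<alpha> L)) x
    = (\<Sum>i\<le>L. (4 ^ i) powr (real k + \<alpha>) * poly ((pderiv ^^ j) (bump k a (2 ^ i))) x)"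
  by (simp add: multiscale_def higher_pderiv_sum higher_pderiv_smult poly_sum)

lemma abs_mono_poly_multiscale:
  assumes "1 \<le> a" "1 \<le> n" "1 \<le> k" "k + (k + a) * (2 ^ L - 1) \<le> n"
  shows "abs_mono_poly (multiscale k a \<alpha> L) k n"
proof
  show "degree (multiscale k a \<alpha> L) \<le> n"
    unfolding multiscale_def
  proof (intro degree_sum_le order_trans[OF degree_smult_le])
    fix i assume "i \<in> {..L}"
    hence "(2::nat) ^ i \<le> 2 ^ L" by (intro power_increasing) auto
    hence "k + (k + a) * (2 ^ i - 1) \<le> k + (k + a) * (2 ^ L - 1)"
      by (intro add_left_mono mult_left_mono diff_le_mono) auto
    thus "degree (bump k a (2 ^ i)) \<le> n" using degree_bump[of k a "2 ^ i"] assms(4) by linarith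
  qed simp
  show "0 \<le> poly ((pderiv ^^ j) (multiscale k a \<alpha> L)) x" if "j \<le> k" "x \<in> {-1..1}" for j x
    unfolding higher_deriv_multiscale using bump_nonneg[OF _ assms(1) that] by (intro sum_nonneg) auto
qed (use assms in auto)

lemma multiscale_le_sum:
  assumes a: "1 \<le> a" and x: "x \<in> {-1..1}"
  shows "poly (multiscale k a \<alpha> L) x \<le> 3 ^ (k + a) * (\<Sum>i\<le>L. (4 ^ i) powr \<alpha> / (1 + 4 ^ i * (1 - x)) ^ a)"
proof -
  have "poly (multiscale k a \<alpha> L) x = (\<Sum>i\<le>L. (4 ^ i) powr (real k + \<alpha>) * poly (bump k a (2 ^ i)) x)"
    using higher_deriv_multiscale[of 0] by simp
  also have "\<dots> \<le> (\<Sum>i\<le>L. (4 ^ i) powr (real k + \<alpha>) * (3 ^ (k + a) / (4 ^ i) ^ k / (1 + 4 ^ i * (1 - x)) ^ a))"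
    using bump_le[OF _ a x, of "2 ^ _" k] by (intro sum_mono mult_left_mono) (auto simp: four_power)
  also have "\<dots> = (\<Sum>i\<le>L. 3 ^ (k + a) * ((4 ^ i) powr \<alpha> / (1 + 4 ^ i * (1 - x)) ^ a))"
    by (intro sum.cong) (auto simp: powr_add powr_realpow)
  finally show ?thesis by (simp add: sum_distrib_left)
qed

text \<open>The terms are bumps in \<open>log y\<close> for \<open>y = Y K\<^sup>i\<close>. Each is dominated by a difference of consecutive
  values of \<open>1 / (1 + y)\<close>, and these telescope, whatever the starting point \<open>Y\<close>.\<close>

lemma sum_log_bump_le:
  fixes K Y :: real
  assumes K: "1 < K" and Y: "0 < Y"
  shows "(\<Sum>i\<le>L. Y * K ^ i / (1 + Y * K ^ i)\<^sup>2) \<le> K / (K - 1)"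
proof -
  define g where "g = (\<lambda>i. 1 / (1 + Y * K ^ i))"
  have t: "Y * K ^ i / (1 + Y * K ^ i)\<^sup>2 \<le> K / (K - 1) * (g i - g (Suc i))" for i
  proof -
    define y where "y = Y * K ^ i"
    have y: "0 < y" using assms by (simp add: y_def)
    have ky: "0 < 1 + K * y" using K y by (simp add: add_pos_pos)
    have "g i - g (Suc i) = 1 / (1 + y) - 1 / (1 + K * y)" by (simp add: g_def y_def mult_ac)
    also have "\<dots> = (K - 1) * (y / ((1 + y) * (1 + K * y)))"
      using y ky by (simp add: divide_simps) (simp add: algebra_simps)
    finally have "K / (K - 1) * (g i - g (Suc i)) = K * y / ((1 + y) * (1 + K * y))" using K by simp
    moreover have "y / (1 + y)\<^sup>2 \<le> K * y / ((1 + y) * (1 + K * y))"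
    proof -
      have "1 + K * y \<le> K * (1 + y)" using K by (simp add: algebra_simps)
      hence "K * y / ((1 + y) * (K * (1 + y))) \<le> K * y / ((1 + y) * (1 + K * y))"
        using y ky K by (intro divide_left_mono mult_left_mono mult_pos_pos) auto
      thus ?thesis using K by (simp add: power2_eq_square)
    qed
    ultimately show ?thesis by (simp add: y_def)
  qed
  have "(\<Sum>i\<le>L. Y * K ^ i / (1 + Y * K ^ i)\<^sup>2) \<le> (\<Sum>i\<le>L. K / (K - 1) * (g i - g (Suc i)))"
    by (intro sum_mono t)
  also have "\<dots> = K / (K - 1) * (g 0 - g (Suc L))"
    unfolding sum_distrib_left[symmetric] by (subst sum_telescope) simp
  also have "\<dots> \<le> K / (K - 1) * 1"
  proof (rule mult_left_mono)
    have "g 0 \<le> 1" "0 \<le> g (Suc L)" using K Y by (auto simp: g_def divide_le_eq)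
    thus "g 0 - g (Suc L) \<le> 1" by linarith
  qed (use K in auto)
  finally show ?thesis by simp
qed

text \<open>The term of scale \<open>z = 4\<^sup>i\<close> is largest where \<open>z\<close> is comparable to \<open>1/v\<close>, with
  \<open>v = 1 - x + 4\<^bsup>-L\<^esup>\<close>, and decays geometrically on both sides, so the sum is of order \<open>v\<^bsup>-\<alpha>\<^esup>\<close>.
  Adding \<open>4\<^bsup>-L\<^esup>\<close> to the distance costs only a constant factor, as \<open>z \<le> 4\<^sup>L\<close>.\<close>

lemma multiscale_le_powr:
  assumes a: "1 \<le> a" "2 * \<alpha> \<le> real a" and \<alpha>: "0 < \<alpha>" and x: "x \<in> {-1..1}"
  shows "poly (multiscale k a \<alpha> L) x
    \<le> 3 ^ (k + a) * (4 powr (\<alpha> + 1) * (4 powr \<alpha> / (4 powr \<alpha> - 1))) * (1 - x + 1 / 4 ^ L) powr (- \<alpha>)"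
proof -
  define u where "u = 1 - x"
  define v where "v = u + 1 / 4 ^ L"
  define K where "K = (4::real) powr \<alpha>"
  define Y where "Y = v powr \<alpha>"
  have u: "0 \<le> u" using x by (simp add: u_def)
  have v: "0 < v" using u by (simp add: v_def add_nonneg_pos)
  have K: "1 < K" using \<alpha> by (simp add: K_def)
  have Y: "0 < Y" using v by (simp add: Y_def)
  have term_le: "(4 ^ i) powr \<alpha> / (1 + 4 ^ i * u) ^ a \<le> 4 powr (\<alpha> + 1) * v powr (- \<alpha>) * (Y * K ^ i / (1 + Y * K ^ i)\<^sup>2)"
    if i: "i \<le> L" for i
  proof -
    define z :: real where "z = 4 ^ i"
    have z: "0 < z" "z / 4 ^ L \<le> 1" using i by (auto simp: z_def power_increasing)
    define y where "y = (z * v) powr \<alpha>"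
    have y0: "0 < y" using z v by (simp add: y_def)
    have zK: "z powr \<alpha> = K ^ i" unfolding z_def K_def
      by (simp add: powr_powr powr_power flip: powr_realpow) (simp add: mult.commute)
    have y: "y = Y * K ^ i" using z v zK by (simp add: y_def Y_def powr_mult)
    have zv: "z * v = z * u + z / 4 ^ L" by (simp add: v_def algebra_simps)
    \<comment> \<open>Passing from \<open>u\<close> to \<open>v = u + 4\<^bsup>-L\<^esup>\<close> adds \<open>z / 4\<^sup>L \<le> 1\<close> to \<open>z u\<close>, so \<open>1 + z u\<close> changes by at
    most a factor \<open>2\<close>.\<close>
    have half: "(1 + (A + B)) / 2 \<le> 1 + A" if "0 \<le> A" "B \<le> 1" for A B :: real using that by simp
    have b: "(1 + z * v) / 2 \<le> 1 + z * u" unfolding zv by (rule half[OF _ z(2)]) (use z u in simp)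
    have zv0: "0 < z * v" using z v by simp
    have "1 + y \<le> 2 * (1 + z * v) powr \<alpha>"
    proof -
      have "1 \<le> (1 + z * v) powr \<alpha>" using zv0 \<alpha> by (simp add: ge_one_powr_ge_zero)
      moreover have "y \<le> (1 + z * v) powr \<alpha>" unfolding y_def using zv0 \<alpha> by (intro powr_mono2) auto
      ultimately show ?thesis by simp
    qed
    hence "(1 + y)\<^sup>2 \<le> (2 * (1 + z * v) powr \<alpha>)\<^sup>2" using y0 by (intro power_mono) auto
    also have "\<dots> = 4 * (1 + z * v) powr (2 * \<alpha>)"
    proof -
      have "(1 + z * v) powr (2 * \<alpha>) = (1 + z * v) powr \<alpha> * (1 + z * v) powr \<alpha>"
        unfolding mult_2 by (rule powr_add)
      thus ?thesis by (simp add: power2_eq_square)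
    qed
    also have "(1 + z * v) powr (2 * \<alpha>) = 4 powr \<alpha> * ((1 + z * v) / 2) powr (2 * \<alpha>)"
    proof -
      have "(4::real) powr \<alpha> = 2 powr (2 * \<alpha>)" using square_powr[of 2 \<alpha>] by simp
      thus ?thesis using zv0 by (simp add: powr_divide)
    qed
    also have "((1 + z * v) / 2) powr (2 * \<alpha>) \<le> (1 + z * u) powr (2 * \<alpha>)"
      using b zv0 \<alpha> by (intro powr_mono2) auto
    also have "(1 + z * u) powr (2 * \<alpha>) \<le> (1 + z * u) powr real a"
      using z u a by (intro powr_mono) auto
    also have "\<dots> = (1 + z * u) ^ a" using z u by (intro powr_realpow) (simp add: add_pos_nonneg)
    finally have "(1 + y)\<^sup>2 \<le> 4 powr (\<alpha> + 1) * (1 + z * u) ^ a" by (simp add: powr_add)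
    moreover have "0 < (1 + z * u) ^ a" using z u by (simp add: add_pos_nonneg)
    ultimately have "1 / (1 + z * u) ^ a \<le> 4 powr (\<alpha> + 1) / (1 + y)\<^sup>2"
      using y0 by (simp add: divide_simps mult.commute)
    hence "z powr \<alpha> * (1 / (1 + z * u) ^ a) \<le> z powr \<alpha> * (4 powr (\<alpha> + 1) / (1 + y)\<^sup>2)"
      by (intro mult_left_mono) auto
    also have za: "z powr \<alpha> = v powr (- \<alpha>) * y"
      using z v by (simp add: y_def powr_mult powr_minus)
    also have "v powr (- \<alpha>) * y * (4 powr (\<alpha> + 1) / (1 + y)\<^sup>2) = 4 powr (\<alpha> + 1) * v powr (- \<alpha>) * (y / (1 + y)\<^sup>2)"
      by simp
    finally show ?thesis unfolding y[symmetric] z_def[symmetric] za by simp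
  qed
  have "poly (multiscale k a \<alpha> L) x \<le> 3 ^ (k + a) * (\<Sum>i\<le>L. (4 ^ i) powr \<alpha> / (1 + 4 ^ i * u) ^ a)"
    using multiscale_le_sum[OF a(1) x] by (simp add: u_def)
  also have "\<dots> \<le> 3 ^ (k + a) * (\<Sum>i\<le>L. 4 powr (\<alpha> + 1) * v powr (- \<alpha>) * (Y * K ^ i / (1 + Y * K ^ i)\<^sup>2))"
    by (intro mult_left_mono sum_mono term_le) auto
  also have "\<dots> = 3 ^ (k + a) * (4 powr (\<alpha> + 1) * v powr (- \<alpha>) * (\<Sum>i\<le>L. Y * K ^ i / (1 + Y * K ^ i)\<^sup>2))"
    by (simp only: sum_distrib_left)
  also have "\<dots> \<le> 3 ^ (k + a) * (4 powr (\<alpha> + 1) * v powr (- \<alpha>) * (K / (K - 1)))"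
    by (intro mult_left_mono sum_log_bump_le K Y) auto
  finally show ?thesis by (simp add: K_def v_def u_def mult_ac)
qed

text \<open>For finite \<open>p\<close> the \<open>p\<close>-th power of the pointwise bound is of order \<open>1 / (1 - x + 4\<^bsup>-L\<^esup>)\<close>, with integral of
  order \<open>L + 1\<close>. For \<open>p = \<infinity>\<close> each of the \<open>L + 1\<close> terms is bounded.\<close>

lemma multiscale_norm_le:
  assumes a: "1 \<le> a" "2 * recip p \<le> real a" and p: "0 < p"
  shows "\<exists>C>0. \<forall>L. Lq_norm p (poly (multiscale k a (recip p) L)) \<le> C * real (Suc L) powr log_loss p"
proof (cases p)
  case PInf
  have "Lq_norm p (poly (multiscale k a (recip p) L)) \<le> 3 ^ (k + a) * real (Suc L) powr log_loss p" for L
  proof -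
    have "(SUP x\<in>{-1..1}. \<bar>poly (multiscale k a 0 L) x\<bar>) \<le> 3 ^ (k + a) * real (Suc L)"
    proof (rule cSUP_least)
      fix x :: real assume x: "x \<in> {-1..1}"
      have "0 \<le> poly (multiscale k a 0 L) x"
        using higher_deriv_multiscale[of 0 k a 0 L x] bump_nonneg[OF _ a(1), of "2 ^ _" 0 k x] x
        by (auto intro!: sum_nonneg)
      moreover have "(\<Sum>i\<le>L. (4 ^ i) powr 0 / (1 + 4 ^ i * (1 - x)) ^ a) \<le> (\<Sum>i\<le>L. 1)"
      proof (rule sum_mono)
        fix i
        have "1 \<le> (1 + 4 ^ i * (1 - x)) ^ a" using x by (intro one_le_power) simp
        thus "(4 ^ i) powr 0 / (1 + 4 ^ i * (1 - x)) ^ a \<le> 1" by (simp add: divide_le_eq_1)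
      qed
      hence "3 ^ (k + a) * (\<Sum>i\<le>L. (4 ^ i) powr 0 / (1 + 4 ^ i * (1 - x)) ^ a) \<le> 3 ^ (k + a) * real (Suc L)"
        by (intro mult_left_mono) auto
      ultimately show "\<bar>poly (multiscale k a 0 L) x\<bar> \<le> 3 ^ (k + a) * real (Suc L)"
        using multiscale_le_sum[OF a(1) x, of k 0 L] by linarith
    qed auto
    thus ?thesis using PInf by (simp add: Lq_norm_def log_loss_def)
  qed
  thus ?thesis by (intro exI[of _ "3 ^ (k + a)"]) auto
next
  case (real r)
  hence r: "0 < r" using p by simp
  define \<alpha> where "\<alpha> = 1 / r"
  have \<alpha>: "0 < \<alpha>" "2 * \<alpha> \<le> real a" "recip p = \<alpha>" "log_loss p = \<alpha>"
    using r a real by (auto simp: \<alpha>_def log_loss_def)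
  define K where "K = 3 ^ (k + a) * (4 powr (\<alpha> + 1) * (4 powr \<alpha> / (4 powr \<alpha> - 1)))"
  have K: "0 < K" using \<alpha> by (simp add: K_def)
  have "Lq_norm p (poly (multiscale k a (recip p) L)) \<le> (K * ln 4 powr \<alpha>) * real (Suc L) powr log_loss p" for L
  proof -
    define \<delta> :: real where "\<delta> = 1 / 4 ^ L"
    have \<delta>: "0 < \<delta>" by (simp add: \<delta>_def)
    let ?Q = "multiscale k a \<alpha> L"
    have hi: "((\<lambda>x. K powr r * (1 / (1 - x + \<delta>))) has_integral
        K powr r * (- ln (1 - 1 + \<delta>)) - K powr r * (- ln (1 - (-1) + \<delta>))) {-1..1}"
    proof (rule fundamental_theorem_of_calculus)
      fix x :: real assume x: "x \<in> {-1..1}"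
      hence "0 < 1 - x + \<delta>" using \<delta> by auto
      hence "((\<lambda>x. K powr r * (- ln (1 - x + \<delta>))) has_real_derivative K powr r * (1 / (1 - x + \<delta>))) (at x)"
        by (auto intro!: derivative_eq_intros simp: divide_simps)
      thus "((\<lambda>x. K powr r * (- ln (1 - x + \<delta>))) has_vector_derivative K powr r * (1 / (1 - x + \<delta>))) (at x within {-1..1})"
        by (simp add: has_real_derivative_iff_has_vector_derivative[symmetric] has_field_derivative_at_within)
    qed simp
    have "integral {-1..1} (\<lambda>x. \<bar>poly ?Q x\<bar> powr r) \<le> integral {-1..1} (\<lambda>x. K powr r * (1 / (1 - x + \<delta>)))"
    proof (rule integral_le)
      show "(\<lambda>x. \<bar>poly ?Q x\<bar> powr r) integrable_on {-1..1}"
        using r by (intro integrable_powr continuous_intros) auto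
      show "(\<lambda>x. K powr r * (1 / (1 - x + \<delta>))) integrable_on {-1..1}"
        using hi by (rule has_integral_integrable)
      fix x :: real assume x: "x \<in> {-1..1}"
      hence pos: "0 < 1 - x + \<delta>" using \<delta> by auto
      have "0 \<le> poly ?Q x"
        using higher_deriv_multiscale[of 0 k a \<alpha> L x] bump_nonneg[OF _ a(1), of "2 ^ _" 0 k x] x
        by (auto intro!: sum_nonneg)
      hence "\<bar>poly ?Q x\<bar> \<le> K * (1 - x + \<delta>) powr (- \<alpha>)"
        using multiscale_le_powr[OF a(1) \<alpha>(2,1) x, of k L] unfolding K_def \<delta>_def by linarith
      hence "\<bar>poly ?Q x\<bar> powr r \<le> (K * (1 - x + \<delta>) powr (- \<alpha>)) powr r"
        using r by (intro powr_mono2) auto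
      also have "\<dots> = K powr r * (1 - x + \<delta>) powr (- 1)"
        using r K pos by (simp add: powr_mult powr_powr \<alpha>_def)
      also have "(1 - x + \<delta>) powr (- 1) = 1 / (1 - x + \<delta>)"
        using pos by (simp add: powr_minus_divide)
      finally show "\<bar>poly ?Q x\<bar> powr r \<le> K powr r * (1 / (1 - x + \<delta>))" .
    qed
    also have "\<dots> = K powr r * (- ln (1 - 1 + \<delta>)) - K powr r * (- ln (1 - (-1) + \<delta>))"
      using hi by (rule integral_unique)
    also have "\<dots> = K powr r * (ln (2 + \<delta>) - ln \<delta>)" by (simp add: algebra_simps)
    also have "ln (2 + \<delta>) - ln \<delta> = ln ((2 + \<delta>) / \<delta>)" using \<delta> by (simp add: ln_div)
    also have "(2 + \<delta>) / \<delta> = 2 * 4 ^ L + 1" by (simp add: \<delta>_def field_simps)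
    also have "ln (2 * 4 ^ L + 1) \<le> ln ((4::real) ^ Suc L)"
    proof -
      have "(1::real) \<le> 4 ^ L" by simp
      hence "2 * 4 ^ L + 1 \<le> (4::real) ^ Suc L" unfolding power_Suc by linarith
      moreover have "0 < 2 * (4::real) ^ L + 1" by (simp add: add_pos_pos)
      ultimately show ?thesis by (subst ln_le_cancel_iff) auto
    qed
    also have "ln ((4::real) ^ Suc L) = real (Suc L) * ln 4" by (rule ln_realpow)
    finally have "integral {-1..1} (\<lambda>x. \<bar>poly ?Q x\<bar> powr r) \<le> K powr r * (real (Suc L) * ln 4)"
      by (simp add: mult_left_mono)
    hence "Lq_norm p (poly ?Q) \<le> (K powr r * (real (Suc L) * ln 4)) powr \<alpha>"
      unfolding real using r
      by (subst Lq_norm_real)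
         (auto intro!: powr_mono2 integral_nonneg integrable_powr continuous_on_poly continuous_on_id simp: \<alpha>_def)
    also have "\<dots> = K * ln 4 powr \<alpha> * real (Suc L) powr \<alpha>"
      using K r by (simp add: powr_mult powr_powr \<alpha>_def)
    finally show ?thesis by (simp add: \<alpha>)
  qed
  moreover have "0 < K * ln 4 powr \<alpha>" using K by simp
  ultimately show ?thesis by blast
qed (use p in auto)

text \<open>In the critical case \<open>1/r = m + \<alpha>\<close>, each shell contributes the same amount to the integral, already
  through the single term of the sum that belongs to its scale.\<close>

lemma multiscale_deriv_norm_ge:
  assumes a: "1 \<le> a" and m: "m \<le> k" and r: "0 < r" "1 / r = real m + \<alpha>"
  shows "bump_height k a * (3/128) powr (1/r) * real (Suc L) powr (1/r)
    \<le> Lq_norm (ereal r) (poly ((pderiv ^^ m) (multiscale k a \<alpha> L)))"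
proof -
  define c where "c = bump_height k a"
  have c: "0 < c" by (simp add: c_def bump_height_pos)
  let ?f = "poly ((pderiv ^^ m) (multiscale k a \<alpha> L))"
  have cont: "continuous_on {-1..1} (\<lambda>x. \<bar>?f x\<bar> powr r)"
    using r by (intro continuous_on_abs_powr continuous_intros)
  have "(\<Sum>i<Suc L. 3/128 * c powr r) \<le> (\<Sum>i<Suc L. integral {1 - 1/32/4^i .. 1 - 1/32/4^Suc i} (\<lambda>x. \<bar>?f x\<bar> powr r))"
  proof (rule sum_mono)
    fix i assume i: "i \<in> {..<Suc L}"
    define z :: real where "z = 4 ^ i"
    have z: "1 \<le> z" by (simp add: z_def)
    let ?a = "1 - 1/32/4^i :: real" and ?b = "1 - 1/32/4^Suc i :: real"
    define h where "h = 1 / (32 * z)"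
    have h: "h \<le> 1" "0 < h" using z by (auto simp: h_def divide_le_eq)
    have ab: "?b - ?a = 3/128 / z" "?a = 1 - h" "?b = 1 - h / 4"
      using z by (auto simp: z_def h_def field_simps)
    have o: "-1 \<le> ?a" "?a \<le> ?b" "?b \<le> 1" using h unfolding ab by linarith+
    have "(c * z powr (1/r)) powr r * (?b - ?a) \<le> integral {?a..?b} (\<lambda>x. \<bar>?f x\<bar> powr r)"
    proof (rule integral_ge_const)
      fix x assume x: "x \<in> {?a..?b}"
      hence x1: "x \<in> {-1..1}" using o by auto
      have "c * z powr (1/r) = z powr (real k + \<alpha>) * (c / z ^ (k - m))"
      proof -
        have "real k + \<alpha> = 1/r + real (k - m)" using m r by (simp add: of_nat_diff)
        thus ?thesis using z by (simp add: powr_add powr_realpow)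
      qed
      also have "\<dots> \<le> z powr (real k + \<alpha>) * poly ((pderiv ^^ m) (bump k a (2 ^ i))) x"
      proof (rule mult_left_mono)
        have W: "z = (real (2 ^ i))\<^sup>2" unfolding z_def by (rule four_power)
        have "1 - 1 / (32 * (real (2 ^ i))\<^sup>2) = 1 - h" unfolding W[symmetric] h_def ..
        hence "x \<in> {1 - 1 / (32 * (real (2 ^ i))\<^sup>2)..1}" using x1 x unfolding ab(2) by simp
        from bump_ge[OF _ a m this] show "c / z ^ (k - m) \<le> poly ((pderiv ^^ m) (bump k a (2 ^ i))) x"
          unfolding c_def bump_height_def W by simp
      qed simp
      also have "\<dots> \<le> (\<Sum>i\<le>L. (4 ^ i) powr (real k + \<alpha>) * poly ((pderiv ^^ m) (bump k a (2 ^ i))) x)"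
        using bump_nonneg[OF _ a m x1] i unfolding z_def
        by (intro member_le_sum) auto
      finally have "c * z powr (1/r) \<le> \<bar>?f x\<bar>" unfolding higher_deriv_multiscale by simp
      thus "(c * z powr (1/r)) powr r \<le> \<bar>?f x\<bar> powr r" using c r by (intro powr_mono2) auto
    qed (use o r in \<open>auto intro!: integrable_powr continuous_on_poly continuous_on_id\<close>)
    moreover have "(c * z powr (1/r)) powr r * (?b - ?a) = 3/128 * c powr r"
      unfolding ab(1) using z c r(1) by (simp add: powr_mult powr_powr)
    ultimately show "3/128 * c powr r \<le> integral {?a..?b} (\<lambda>x. \<bar>?f x\<bar> powr r)" by simp
  qed
  also have "\<dots> = integral {1 - 1/32 .. 1 - 1/32/4^Suc L} (\<lambda>x. \<bar>?f x\<bar> powr r)"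
    by (intro integral_shells cont) auto
  also have "\<dots> \<le> integral {-1..1} (\<lambda>x. \<bar>?f x\<bar> powr r)"
    by (intro integral_mono_interval cont) auto
  finally have "real (Suc L) * (3/128 * c powr r) \<le> integral {-1..1} (\<lambda>x. \<bar>?f x\<bar> powr r)" by simp
  hence "(real (Suc L) * (3/128 * c powr r)) powr (1/r) \<le> Lq_norm (ereal r) ?f"
    using r(1) by (subst Lq_norm_real) (auto intro!: powr_mono2 continuous_on_poly continuous_on_id)
  moreover have "(real (Suc L) * (3/128 * c powr r)) powr (1/r) = c * (3/128) powr (1/r) * real (Suc L) powr (1/r)"
    using c r(1) by (simp only: powr_mult) (simp add: powr_powr)
  ultimately show ?thesis by (simp add: c_def)
qed

text \<open>The three rates come from the bump of the largest admissible scale, from the sum of bumps of all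
  admissible scales \<open>2\<^sup>i\<close>, and from the bump of scale \<open>1\<close>.\<close>

lemma markov_const_ge_rate:
  assumes p: "0 < p" and q: "0 < q" and m: "1 \<le> m" "m \<le> k"
  shows "\<exists>c>0. \<forall>n. 2 \<le> n \<longrightarrow> k \<le> n \<longrightarrow> ereal (c * markov_rate q p m n) \<le> markov_const k q p n m"
proof -
  define \<alpha> \<beta> where "\<alpha> = recip p" and "\<beta> = recip q"
  \<comment> \<open>Decay of order \<open>2\<alpha>\<close> serves both the norm of one bump and the sum of bumps.\<close>
  define a where "a = nat \<lceil>2 * \<alpha>\<rceil> + 1"
  have a: "1 \<le> a" "2 * \<alpha> \<le> real a" by (simp_all add: a_def) linarith
  define s where "s = k + a"
  have s: "k \<le> s" "1 \<le> s" using a by (auto simp: s_def)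
  define c1 where "c1 = bump_height k a * (1/32) powr \<beta> / 3 ^ (k + a)"
  have c1: "0 < c1" using bump_height_pos[of k a] by (simp add: c1_def)
  have single: "ereal (c1 * ((real M)\<^sup>2) powr (real m + \<alpha> - \<beta>)) \<le> markov_const k q p n m"
    if "1 \<le> M" "k + s * (M - 1) \<le> n" "2 \<le> n" for M n
    using markov_const_ge_single_bump[OF that(1) _ a(1) _ that(3) p q m] that a
    unfolding c1_def \<alpha>_def \<beta>_def s_def by simp
  consider "real m > \<beta> - \<alpha>" | "real m = \<beta> - \<alpha>" | "real m < \<beta> - \<alpha>" by linarith
  thus ?thesis
  proof cases
    case 1
    define \<gamma> where "\<gamma> = real m + \<alpha> - \<beta>"
    have \<gamma>: "0 < \<gamma>" using 1 by (simp add: \<gamma>_def)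
    define c where "c = c1 * (1 / (2 * real s)) powr (2 * \<gamma>)"
    have "ereal (c * markov_rate q p m n) \<le> markov_const k q p n m" if n: "2 \<le> n" "k \<le> n" for n
    proof -
      obtain M where M: "1 \<le> M" "k + s * (M - 1) \<le> n" "n \<le> 2 * s * M"
        using scale_exists[OF s(1) n(2) s(2)] by blast
      have "real n \<le> real (2 * s * M)" using M(3) by (simp only: of_nat_le_iff)
      hence "1 / (2 * real s) * real n \<le> real M" using s by (simp add: field_simps)
      hence "(1 / (2 * real s) * real n) powr (2 * \<gamma>) \<le> real M powr (2 * \<gamma>)"
        using \<gamma> by (intro powr_mono2) auto
      also have "\<dots> = ((real M)\<^sup>2) powr \<gamma>" using M by (simp add: square_powr)
      finally have "(1 / (2 * real s)) powr (2 * \<gamma>) * real n powr (2 * \<gamma>) \<le> ((real M)\<^sup>2) powr \<gamma>"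
        by (simp only: powr_mult)
      hence "c * real n powr (2 * \<gamma>) \<le> c1 * ((real M)\<^sup>2) powr \<gamma>"
        using c1 unfolding c_def mult.assoc by (intro mult_left_mono) auto
      moreover have "markov_rate q p m n = real n powr (2 * \<gamma>)"
        using 1 by (simp add: markov_rate_def \<gamma>_def \<alpha>_def \<beta>_def algebra_simps)
      ultimately show ?thesis
        using single[OF M(1,2) n(1)] by (simp add: \<gamma>_def) (meson ereal_less_eq(3) order_trans)
    qed
    moreover have "0 < c" using c1 s by (simp add: c_def)
    ultimately show ?thesis by blast
  next
    case 3
    have "ereal (c1 * markov_rate q p m n) \<le> markov_const k q p n m" if n: "2 \<le> n" "k \<le> n" for n
      using single[of 1 n] n 3 by (simp add: markov_rate_def \<alpha>_def \<beta>_def)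
    thus ?thesis using c1 by blast
  next
    case 2
    have \<alpha>0: "0 \<le> \<alpha>" using p by (simp add: \<alpha>_def recip_nonneg)
    have "0 < \<beta>" using 2 \<alpha>0 m by linarith
    then obtain r where r: "q = ereal r" "0 < r" using q by (cases q) (auto simp: \<beta>_def)
    have \<beta>: "\<beta> = 1 / r" using r by (simp add: \<beta>_def)
    define \<rho> where "\<rho> = log_loss p"
    have \<rho>: "0 \<le> \<beta> - \<rho>"
    proof (cases "p = \<infinity>")
      case True
      thus ?thesis using 2 m by (simp add: \<rho>_def log_loss_def \<alpha>_def)
    next
      case False
      thus ?thesis using 2 m by (simp add: \<rho>_def log_loss_def \<alpha>_def)
    qed
    obtain C where C: "0 < C" "\<And>L. Lq_norm p (poly (multiscale k a \<alpha> L)) \<le> C * real (Suc L) powr \<rho>"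
      using multiscale_norm_le[of a p k] a p unfolding \<alpha>_def \<rho>_def by blast
    define c2 where "c2 = bump_height k a * (3/128) powr \<beta> / C"
    have c2: "0 < c2" using bump_height_pos[of k a] C by (simp add: c2_def)
    \<comment> \<open>As \<open>n \<le> 2s 2\<^bsup>L+1\<^esup>\<close>, the logarithm of \<open>n\<close> is at most \<open>(L + 1) T\<close>.\<close>
    define T where "T = ln (2 * real s) + ln 2"
    have T: "0 < T" using s by (simp add: T_def add_pos_pos)
    define c where "c = c2 * (1 / T) powr (\<beta> - \<rho>)"
    have "ereal (c * markov_rate q p m n) \<le> markov_const k q p n m" if n: "2 \<le> n" "k \<le> n" for n
    proof -
      obtain M where M: "1 \<le> M" "k + s * (M - 1) \<le> n" "n \<le> 2 * s * M"
        using scale_exists[OF s(1) n(2) s(2)] by blast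
      obtain L where L: "2 ^ L \<le> M" "M < 2 ^ (L + 1)" using ex_power_ivl1[of 2 M] M by auto
      have "k + s * (2 ^ L - 1) \<le> k + s * (M - 1)"
        using L by (intro add_left_mono mult_left_mono diff_le_mono) auto
      also have "\<dots> \<le> n" by (rule M)
      finally have degL: "k + (k + a) * (2 ^ L - 1) \<le> n" unfolding s_def .
      have amp: "abs_mono_poly (multiscale k a \<alpha> L) k n"
        using a n m degL by (intro abs_mono_poly_multiscale) auto
      have "ereal ((bump_height k a * (3/128) powr \<beta> * real (Suc L) powr \<beta>) / (C * real (Suc L) powr \<rho>))
          \<le> markov_const k q p n m"
      proof (rule markov_const_ge[OF amp n(1) p q m])
        show "0 < bump_height k a * (3/128) powr \<beta> * real (Suc L) powr \<beta>"
          using bump_height_pos[of k a] by simp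
        show "bump_height k a * (3/128) powr \<beta> * real (Suc L) powr \<beta>
            \<le> Lq_norm q (poly ((pderiv ^^ m) (multiscale k a \<alpha> L)))"
          unfolding \<beta> r(1) using 2 \<beta> r(2) a m by (intro multiscale_deriv_norm_ge) auto
        show "Lq_norm p (poly (multiscale k a \<alpha> L)) \<le> C * real (Suc L) powr \<rho>" by (rule C)
      qed
      also have "(bump_height k a * (3/128) powr \<beta> * real (Suc L) powr \<beta>) / (C * real (Suc L) powr \<rho>)
          = c2 * real (Suc L) powr (\<beta> - \<rho>)"
        by (simp add: c2_def powr_diff)
      finally have 1: "ereal (c2 * real (Suc L) powr (\<beta> - \<rho>)) \<le> markov_const k q p n m" .
      have "2 * s * M \<le> 2 * s * 2 ^ Suc L" using L(2) by (intro mult_left_mono) auto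
      hence "n \<le> 2 * s * 2 ^ Suc L" using M(3) by (rule le_trans[rotated])
      hence "real n \<le> real (2 * s * 2 ^ Suc L)" by (simp only: of_nat_le_iff)
      hence "ln (real n) \<le> ln (2 * real s * 2 ^ Suc L)" using n s by (subst ln_le_cancel_iff) auto
      also have "\<dots> = ln (2 * real s) + real (Suc L) * ln 2"
        using s by (subst ln_mult) (simp_all add: ln_realpow del: power_Suc)
      also have "\<dots> \<le> real (Suc L) * ln (2 * real s) + real (Suc L) * ln 2"
        using s by simp
      finally have "ln (real n) \<le> real (Suc L) * T" by (simp add: T_def algebra_simps)
      hence "1 / T * ln (real n) \<le> real (Suc L)" using T by (simp add: field_simps)
      hence "(1 / T * ln (real n)) powr (\<beta> - \<rho>) \<le> real (Suc L) powr (\<beta> - \<rho>)"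
        using \<rho> T n by (intro powr_mono2) auto
      hence "(1 / T) powr (\<beta> - \<rho>) * ln (real n) powr (\<beta> - \<rho>) \<le> real (Suc L) powr (\<beta> - \<rho>)"
        by (simp only: powr_mult)
      hence "c * ln (real n) powr (\<beta> - \<rho>) \<le> c2 * real (Suc L) powr (\<beta> - \<rho>)"
        using c2 unfolding c_def mult.assoc by (intro mult_left_mono) auto
      moreover have "markov_rate q p m n = ln (real n) powr (\<beta> - \<rho>)"
        using 2 by (simp add: markov_rate_def \<alpha>_def \<beta>_def \<rho>_def)
      ultimately show ?thesis using 1 by (metis ereal_less_eq(3) order_trans)
    qed
    moreover have "0 < c" using c2 T by (simp add: c_def)
    ultimately show ?thesis by blast
  qed
qed

section \<open>The order of the Markov constants\<close>

lemma markov_const_le_rate: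
  assumes p: "0 < p" and q: "0 < q" and m: "1 \<le> m" "m \<le> k"
  shows "\<exists>C>0. \<forall>n. 2 \<le> n \<longrightarrow> markov_const k q p n m \<le> ereal (C * markov_rate q p m n)"
proof -
  obtain C where C: "0 < C" and le: "\<And>n P. 2 \<le> n \<Longrightarrow> abs_mono_poly P k n \<Longrightarrow>
    Lq_norm q (poly ((pderiv ^^ m) P)) \<le> C * markov_rate q p m n * Lq_norm p (poly P)"
    using norm_deriv_le_rate[OF p q m] by blast
  have "markov_const k q p n m \<le> ereal (C * markov_rate q p m n)" if n: "2 \<le> n" for n
    unfolding markov_const_def
  proof (rule SUP_least)
    fix P assume "P \<in> abs_mono_polys k n - {0}"
    hence amp: "abs_mono_poly P k n" using abs_mono_polys_iff[of n k P] n m by simp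
    let ?N = "Lq_norm p (poly P)"
    have N0: "0 \<le> ?N" by (intro Lq_norm_nonneg p continuous_intros)
    have R: "0 \<le> C * markov_rate q p m n" using C markov_rate_nonneg by simp
    have "Lq_norm q (poly ((pderiv ^^ m) P)) / ?N \<le> C * markov_rate q p m n"
    proof (cases "?N = 0")
      case False
      thus ?thesis using le[OF n amp] N0 by (simp add: divide_le_eq)
    qed (use R in simp)
    thus "ereal (Lq_norm q (poly ((pderiv ^^ m) P)) / ?N) \<le> ereal (C * markov_rate q p m n)" by simp
  qed
  thus ?thesis using C by blast
qed

text \<open>Only finitely many \<open>m\<close> occur for fixed \<open>k\<close>, so constants that depend on \<open>m\<close> can be made uniform.\<close>

lemma markov_const_order:
  assumes p: "0 < p" and q: "0 < q"
  shows "\<exists>c C :: real. 0 < c \<and> 0 < C \<and>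
    (\<forall>m n. 0 < m \<and> m \<le> k \<and> max k 2 \<le> n \<longrightarrow>
      ereal (c * markov_rate q p m n) \<le> markov_const k q p n m \<and>
      markov_const k q p n m \<le> ereal (C * markov_rate q p m n))"
proof -
  have "\<forall>m. \<exists>c>0. 1 \<le> m \<longrightarrow> m \<le> k \<longrightarrow>
      (\<forall>n. 2 \<le> n \<longrightarrow> k \<le> n \<longrightarrow> ereal (c * markov_rate q p m n) \<le> markov_const k q p n m)"
    using markov_const_ge_rate[OF p q] zero_less_one by meson
  then obtain c where c: "\<And>m. 0 < c m" "\<And>m n. 1 \<le> m \<Longrightarrow> m \<le> k \<Longrightarrow> 2 \<le> n \<Longrightarrow> k \<le> n \<Longrightarrow>
      ereal (c m * markov_rate q p m n) \<le> markov_const k q p n m" by metis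
  have "\<forall>m. \<exists>C>0. 1 \<le> m \<longrightarrow> m \<le> k \<longrightarrow>
      (\<forall>n. 2 \<le> n \<longrightarrow> markov_const k q p n m \<le> ereal (C * markov_rate q p m n))"
    using markov_const_le_rate[OF p q] zero_less_one by meson
  then obtain C where C: "\<And>m. 0 < C m" "\<And>m n. 1 \<le> m \<Longrightarrow> m \<le> k \<Longrightarrow> 2 \<le> n \<Longrightarrow>
      markov_const k q p n m \<le> ereal (C m * markov_rate q p m n)" by metis
  define c' C' where "c' = Min (c ` {..k})" and "C' = Max (C ` {..k})"
  have "0 < c'" "0 < C'" using c(1) C(1) by (auto simp: c'_def C'_def Max_gr_iff)
  moreover have "ereal (c' * markov_rate q p m n) \<le> markov_const k q p n m \<and>
      markov_const k q p n m \<le> ereal (C' * markov_rate q p m n)"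
    if "0 < m \<and> m \<le> k \<and> max k 2 \<le> n" for m n
  proof
    have "c' \<le> c m" "C m \<le> C'" using that by (auto simp: c'_def C'_def)
    hence "c' * markov_rate q p m n \<le> c m * markov_rate q p m n"
      "C m * markov_rate q p m n \<le> C' * markov_rate q p m n"
      by (auto intro: mult_right_mono markov_rate_nonneg)
    moreover have "ereal (c m * markov_rate q p m n) \<le> markov_const k q p n m"
      "markov_const k q p n m \<le> ereal (C m * markov_rate q p m n)"
      using that c(2) C(2) by auto
    ultimately show "ereal (c' * markov_rate q p m n) \<le> markov_const k q p n m"
      "markov_const k q p n m \<le> ereal (C' * markov_rate q p m n)"
      by (meson ereal_less_eq(3) order_trans)+
  qed
  ultimately show ?thesis by blast
qed

lemma rate_finite_eq:
  assumes "p \<noteq> \<infinity>" "2 \<le> n"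
  shows "rate_finite q p m n = markov_rate q p m n"
  using assms by (auto simp: rate_finite_def markov_rate_def log_loss_def powr_realpow[symmetric])

lemma rate_infinite_eq:
  assumes "1 \<le> m" "2 \<le> n"
  shows "rate_infinite q m n = markov_rate q \<infinity> m n"
  using assms by (auto simp: rate_infinite_def markov_rate_def log_loss_def powr_realpow[symmetric] of_nat_diff)

theorem theorem1p6:
  fixes k :: nat and p q :: ereal
  assumes "0 < p" and "0 < q"
  shows
    "(p \<noteq> \<infinity> \<longrightarrow>
       (\<exists>c C :: real. 0 < c \<and> 0 < C \<and>
         (\<forall>m n. 0 < m \<and> m \<le> k \<and> max k 2 \<le> n \<longrightarrow>
            ereal (c * rate_finite q p m n) \<le> markov_const k q p n m \<and>
            markov_const k q p n m \<le> ereal (C * rate_finite q p m n))))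
     \<and>
     (\<exists>c C :: real. 0 < c \<and> 0 < C \<and>
         (\<forall>m n. 0 < m \<and> m \<le> k \<and> max k 2 \<le> n \<longrightarrow>
            ereal (c * rate_infinite q m n) \<le> markov_const k q \<infinity> n m \<and>
            markov_const k q \<infinity> n m \<le> ereal (C * rate_infinite q m n)))"
proof (intro conjI impI)
  assume "p \<noteq> \<infinity>"
  thus "\<exists>c C :: real. 0 < c \<and> 0 < C \<and>
         (\<forall>m n. 0 < m \<and> m \<le> k \<and> max k 2 \<le> n \<longrightarrow>
            ereal (c * rate_finite q p m n) \<le> markov_const k q p n m \<and>
            markov_const k q p n m \<le> ereal (C * rate_finite q p m n))"
    using markov_const_order[OF assms, of k] by (simp add: rate_finite_eq)
next
  show "\<exists>c C :: real. 0 < c \<and> 0 < C \<and>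
         (\<forall>m n. 0 < m \<and> m \<le> k \<and> max k 2 \<le> n \<longrightarrow>
            ereal (c * rate_infinite q m n) \<le> markov_const k q \<infinity> n m \<and>
            markov_const k q \<infinity> n m \<le> ereal (C * rate_infinite q m n))"
    using markov_const_order[of \<infinity> q k] assms by (simp add: rate_infinite_eq Suc_le_eq cong: conj_cong)
qed

end
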